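(* Consider a generator node $i$ with dynamics $$\dot\delta_i=\omega_i,\qquad \dot\omega_i=\frac{-k_i\omega_i-\sum_{j\in\mathcal N_i}a_{ij}\sin(\delta_i-d_i^j)+P_{m_i}}{m_i},$$ state $x_i=(\delta_i,\omega_i)^T$, disturbance $d_i=(d_i^j)_{j\in\mathcal N_i}$ with $d_i(t)\in D_i=\prod_{j\in\mathcal N_i}[\underline\delta_j,\overline\delta_j]$ for all $t$, and state constraint $\delta_i(t)\in[\underline\delta_i,\overline\delta_i]$ for all $t$. Let $G_-=\{(\delta_i,\omega_i)^T:\underline\delta_i<\delta_i<\overline\delta_i\}$. There exists a candidate barrier trajectory, associated with the maximal robust positively invariant set (MRPI) or the admissible set, partly contained in $G_-$ and ending at the point of ultimate tangentiality $(\overline\delta_i,0)^T$ (resp. $(\underline\delta_i,0)^T$), if and only if $$\sum_{j\in\mathcal N_i}a_{ij}\sin\big(\overline\delta_i-\bar d_i^j(\bar t)\big)-P_{m_i}>0$$ $$\Big(\text{resp.}\quad\sum_{j\in\mathcal N_i}a_{ij}\sin\big(\underline\delta_i-\bar d_i^j(\bar t)\big)-P_{m_i}<0\Big).$$ Here $\bar t$ is the time at which the trajectory reaches its end point and $\bar d_i=(\bar d_i^j)_{j\in\mathcal N_i}$ is the disturbance realisation associated with the trajectory, as specified in the context for the MRPI and for the admissible set respectively.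
   Context: Setting. Node $i$ of a power grid is a generator with set of neighbouring nodes $\mathcal N_i$; $\delta_i$ is its rotor angle relative to a reference and $\omega_i=\dot\delta_i$. The parameters $m_i$ (rotor mass, $m_i>0$), $k_i$ (damping), $P_{m_i}$ (mechanical input torque) and $a_{ij}$ (line coupling) are nonnegative constants; $\underline\delta_i,\overline\delta_i$ and $\underline\delta_j,\overline\delta_j$ are scalar constants. The neighbours' angles are treated as disturbance inputs $d_i^j$, and the disturbances are all Lebesgue measurable functions with values in the compact convex set $D_i$. Write $f(x_i,d_i)$ for the right-hand side of the dynamics. The constraint functions are $g_i^1(x_i)=\delta_i-\overline\delta_i$ and $g_i^2(x_i)=-\delta_i+\underline\delta_i$, and $G=\{x_i: g_i^1(x_i)\le 0,\ g_i^2(x_i)\le 0\}$, so that $G_-$ is the set where both are strictly negative. Sets. The admissible set is the set of initial states from which there exists a disturbance such that the solution stays in $G$ for all future time. The MRPI is the set of initial states from which the solution stays in $G$ for all future time for every disturbance. The part of the boundary of either set lying in $G_-$ is called its barrier. Points of ultimate tangentiality. These are the points $z$ on the constraint boundary at which $\max_{d\in D_i}\nabla g(z)f(z,d)=0$ (MRPI), resp. $\min_{d\in D_i}\nabla g(z)f(z,d)=0$ (admissible set), where $g$ is the constraint function active at $z$. For both sets they are $(\overline\delta_i,0)^T$ (with $g_i^1$ active) and $(\underline\delta_i,0)^T$ (with $g_i^2$ active). Candidate barrier trajectories. These are the trajectories obtained from the necessary conditions for barrier trajectories: starting from a point of ultimate tangentiality $z=x_i(\bar t)$, one integrates backwards in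 time from $\bar t$ the dynamics $\dot x_i=f(x_i,\bar d_i)$ together with the adjoint equation for $\lambda_i=(\lambda_i^1,\lambda_i^2)^T$, $$\dot\lambda_i^1(t)=\Big(\sum_{j\in\mathcal N_i}\frac{a_{ij}}{m_i}\cos\big(\delta_i(t)-\bar d_i^j(t)\big)\Big)\lambda_i^2(t),\qquad \dot\lambda_i^2(t)=-\lambda_i^1(t)+\frac{k_i}{m_i}\lambda_i^2(t),$$ with final condition $\lambda_i(\bar t)=(\nabla g(z))^T$ for the active constraint function $g$, i.e. $(1,0)^T$ at $(\overline\delta_i,0)^T$ and $(-1,0)^T$ at $(\underline\delta_i,0)^T$, where $\bar d_i$ is to satisfy, for almost every $t\le\bar t$, $$\max_{d\in D_i}\lambda_i(t)^Tf(x_i(t),d)=\lambda_i(t)^Tf(x_i(t),\bar d_i(t))=0\quad\text{(MRPI)},$$ $$\min_{d\in D_i}\lambda_i(t)^Tf(x_i(t),d)=\lambda_i(t)^Tf(x_i(t),\bar d_i(t))=0\quad\text{(admissible set)}.$$ They are called candidates because the conditions are only necessary, so that some of these trajectories, or parts of them (for instance parts outside $G$), may not belong to the barrier. Disturbance realisation. The realisation deduced from the Hamiltonian condition and used for $\bar d_i$ is, for each $j\in\mathcal N_i$, with $\mathsf{sat}(x,\overline x,\underline x)$ denoting the saturation of $x$ with upper bound $\overline x$ and lower bound $\underline x$: - MRPI: $\bar d_i^j(t)=\mathsf{sat}(\delta_i(t)+\tfrac{\pi}{2},\overline\delta_j,\underline\delta_j)$ if $\lambda_i^2(t)\ge 0$,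 and $\bar d_i^j(t)=\mathsf{sat}(\delta_i(t)-\tfrac{\pi}{2},\overline\delta_j,\underline\delta_j)$ if $\lambda_i^2(t)<0$; - admissible set: $\bar d_i^j(t)=\mathsf{sat}(\delta_i(t)-\tfrac{\pi}{2},\overline\delta_j,\underline\delta_j)$ if $\lambda_i^2(t)\ge 0$, and $\bar d_i^j(t)=\mathsf{sat}(\delta_i(t)+\tfrac{\pi}{2},\overline\delta_j,\underline\delta_j)$ if $\lambda_i^2(t)<0$.
   Formalization: The value of d̄ at t̄ is its limit from the left (at the lower point the λ²<0 branch); "partly contained in G_-" means the final arc before t̄ lies in G_-; d̄ is the saturated realisation, required extremal only when all neighbour angles lie within π of the saturated angle. *)

theory Defs
  imports "HOL-Analysis.Analysis"
begin

record 'n grid =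
  nbrs :: "'n \<Rightarrow> 'n set"
  mass :: "'n \<Rightarrow> real"
  damping :: "'n \<Rightarrow> real"
  torque :: "'n \<Rightarrow> real"
  coupling :: "'n \<Rightarrow> 'n \<Rightarrow> real"
  ang_lo :: "'n \<Rightarrow> real"
  ang_hi :: "'n \<Rightarrow> real"

text \<open>The strict inequality for node \<open>i\<close> says that \<open>G_minus\<close> below is nonempty; the
  non-strict ones say that the disturbance box is nonempty.\<close>

definition generator :: "('n, 'z) grid_scheme \<Rightarrow> 'n \<Rightarrow> bool" where
  "generator g i \<longleftrightarrow>
     finite (nbrs g i) \<and> mass g i > 0 \<and> damping g i \<ge> 0 \<and> torque g i \<ge> 0 \<and>
     (\<forall>j\<in>nbrs g i. coupling g i j \<ge> 0) \<and>
     ang_lo g i < ang_hi g i \<and> (\<forall>j\<in>nbrs g i. ang_lo g j \<le> ang_hi g j)"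

text \<open>States are pairs (angle, angular velocity).\<close>

definition dyn :: "('n, 'z) grid_scheme \<Rightarrow> 'n \<Rightarrow> real \<times> real \<Rightarrow> ('n \<Rightarrow> real) \<Rightarrow> real \<times> real" where
  "dyn g i x d =
     (snd x,
      (- damping g i * snd x - (\<Sum>j\<in>nbrs g i. coupling g i j * sin (fst x - d j)) + torque g i)
        / mass g i)"

definition adjoint_dyn ::
  "('n, 'z) grid_scheme \<Rightarrow> 'n \<Rightarrow> real \<times> real \<Rightarrow> ('n \<Rightarrow> real) \<Rightarrow> real \<times> real \<Rightarrow> real \<times> real" where
  "adjoint_dyn g i x d l =
     ((\<Sum>j\<in>nbrs g i. coupling g i j / mass g i * cos (fst x - d j)) * snd l,
      - fst l + damping g i / mass g i * snd l)"

definition disturbances :: "('n, 'z) grid_scheme \<Rightarrow> 'n \<Rightarrow> ('n \<Rightarrow> real) set" where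
  "disturbances g i = Pi (nbrs g i) (\<lambda>j. {ang_lo g j..ang_hi g j})"

definition G_minus :: "('n, 'z) grid_scheme \<Rightarrow> 'n \<Rightarrow> (real \<times> real) set" where
  "G_minus g i = {x. ang_lo g i < fst x \<and> fst x < ang_hi g i}"

datatype safe_set = MRPI | Admissible

text \<open>The face of the constraint set at which a trajectory ends: \<open>Upper\<close> stands for the
  constraint function \<open>\<lambda>x. fst x - ang_hi g i\<close>, \<open>Lower\<close> for \<open>\<lambda>x. - fst x + ang_lo g i\<close>.\<close>

datatype face = Upper | Lower

fun tangency_point :: "('n, 'z) grid_scheme \<Rightarrow> 'n \<Rightarrow> face \<Rightarrow> real \<times> real" where
  "tangency_point g i Upper = (ang_hi g i, 0)"
| "tangency_point g i Lower = (ang_lo g i, 0)"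

fun constraint_gradient :: "face \<Rightarrow> real \<times> real" where
  "constraint_gradient Upper = (1, 0)"
| "constraint_gradient Lower = (- 1, 0)"

text \<open>Saturation with upper bound \<open>u\<close> and lower bound \<open>l\<close>, in this argument order.\<close>

definition sat :: "real \<Rightarrow> real \<Rightarrow> real \<Rightarrow> real" where
  "sat v u l = max l (min v u)"

text \<open>The angle that is saturated in the disturbance realisation; \<open>l2\<close> is the second component of
  the adjoint.\<close>

fun target_angle :: "safe_set \<Rightarrow> real \<Rightarrow> real \<Rightarrow> real" where
  "target_angle MRPI \<delta> l2 = (if l2 \<ge> 0 then \<delta> + pi / 2 else \<delta> - pi / 2)"
| "target_angle Admissible \<delta> l2 = (if l2 \<ge> 0 then \<delta> - pi / 2 else \<delta> + pi / 2)"

definition dist_real ::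
  "('n, 'z) grid_scheme \<Rightarrow> safe_set \<Rightarrow> (real \<Rightarrow> real \<times> real) \<Rightarrow> (real \<Rightarrow> real \<times> real)
     \<Rightarrow> real \<Rightarrow> 'n \<Rightarrow> real" where
  "dist_real g S x lam t j =
     sat (target_angle S (fst (x t)) (snd (lam t))) (ang_hi g j) (ang_lo g j)"

text \<open>The value of the realisation at the end time \<open>tb\<close>. The trajectory is integrated backwards
  from \<open>tb\<close>, and the realisation matters only up to null sets. Since the second component of the
  adjoint vanishes at \<open>tb\<close> itself, the relevant value is the one-sided limit. At the upper face it
  agrees with \<open>dist_real g S x lam tb\<close>; at the lower face the second adjoint component is
  negative just before \<open>tb\<close>, so pointwise evaluation at \<open>tb\<close> would select the branch that the
  trajectory does not use there.\<close>

definition end_dist ::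
  "('n, 'z) grid_scheme \<Rightarrow> safe_set \<Rightarrow> (real \<Rightarrow> real \<times> real) \<Rightarrow> (real \<Rightarrow> real \<times> real)
     \<Rightarrow> real \<Rightarrow> 'n \<Rightarrow> real" where
  "end_dist g S x lam tb j = Lim (at_left tb) (\<lambda>t. dist_real g S x lam t j)"

definition hamiltonian ::
  "('n, 'z) grid_scheme \<Rightarrow> 'n \<Rightarrow> real \<times> real \<Rightarrow> real \<times> real \<Rightarrow> ('n \<Rightarrow> real) \<Rightarrow> real" where
  "hamiltonian g i x l d = l \<bullet> dyn g i x d"

fun extremal :: "safe_set \<Rightarrow> ('d \<Rightarrow> real) \<Rightarrow> 'd set \<Rightarrow> 'd \<Rightarrow> bool" where
  "extremal MRPI H D d = is_arg_max H (\<lambda>e. e \<in> D) d"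
| "extremal Admissible H D d = is_arg_min H (\<lambda>e. e \<in> D) d"

text \<open>Saturation picks the value nearest to the target angle on the real line. This optimises the
  Hamiltonian, whose terms are cosines of the distance to the target angle, when all disturbance
  values are within half a turn of the target angle.\<close>

definition within_half_turn :: "('n, 'z) grid_scheme \<Rightarrow> 'n \<Rightarrow> safe_set \<Rightarrow> real \<Rightarrow> real \<Rightarrow> bool" where
  "within_half_turn g i S \<delta> l2 \<longleftrightarrow>
     (\<forall>j\<in>nbrs g i. \<forall>e\<in>{ang_lo g j..ang_hi g j}. \<bar>e - target_angle S \<delta> l2\<bar> \<le> pi)"

text \<open>Both differential equations hold almost everywhere, for absolutely continuous functions on
  the half-line up to \<open>tb\<close>; this is expressed in integrated form. The disturbance is the saturated
  realisation throughout. Its optimality is part of the definition only where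
  \<open>within_half_turn\<close> holds: a trajectory followed back far enough can leave this range (for instance
  outside the constraint set), and there the saturated realisation need not be optimal.\<close>

definition candidate ::
  "('n, 'z) grid_scheme \<Rightarrow> 'n \<Rightarrow> safe_set \<Rightarrow> face \<Rightarrow> real
     \<Rightarrow> (real \<Rightarrow> real \<times> real) \<Rightarrow> (real \<Rightarrow> real \<times> real) \<Rightarrow> bool" where
  "candidate g i S F tb x lam \<longleftrightarrow>
     x tb = tangency_point g i F \<and> lam tb = constraint_gradient F \<and>
     (\<forall>t\<le>tb. ((\<lambda>s. dyn g i (x s) (dist_real g S x lam s)) has_integral (x tb - x t)) {t..tb}) \<and>
     (\<forall>t\<le>tb. ((\<lambda>s. adjoint_dyn g i (x s) (dist_real g S x lam s) (lam s))
                has_integral (lam tb - lam t)) {t..tb}) \<and>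
     (AE t in lebesgue. t \<le> tb \<longrightarrow>
        hamiltonian g i (x t) (lam t) (dist_real g S x lam t) = 0 \<and>
        (within_half_turn g i S (fst (x t)) (snd (lam t)) \<longrightarrow>
           extremal S (hamiltonian g i (x t) (lam t)) (disturbances g i) (dist_real g S x lam t)))"

text \<open>The part of the trajectory leading to its end point lies in \<open>G_minus\<close>. (A visit to
  \<open>G_minus\<close> at some much earlier time does not count.)\<close>

definition partly_in_G_minus ::
  "('n, 'z) grid_scheme \<Rightarrow> 'n \<Rightarrow> real \<Rightarrow> (real \<Rightarrow> real \<times> real) \<Rightarrow> bool" where
  "partly_in_G_minus g i tb x \<longleftrightarrow> (\<exists>t0<tb. \<forall>t\<in>{t0<..<tb}. x t \<in> G_minus g i)"

end

theory Submission
  imports Defs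
begin

text \<open>
  For a fixed sign of the second adjoint component the realisation depends on the angle only, and
  \<open>\<delta> \<mapsto> sin (\<delta> - sat (\<delta> \<plusminus> \<pi>/2))\<close> is continuously differentiable, because the disturbance is
  unsaturated only where the sine is critical. Each of the two branches is thus a globally Lipschitz
  equation for which the Hamiltonian is a first integral. The adjoint never vanishes, so its second
  component has only simple zeros, at which the other branch takes over; consecutive zeros are
  separated by a fixed time. Hence candidate trajectories exist on the whole half-line.

  Just before the end time every candidate follows the branch given by the sign of the constraint
  gradient. Its angular velocity vanishes at the end point, so the sign of the acceleration there
  decides from which side the angle reaches the constraint; if the acceleration is zero, the end
  point is an equilibrium of the branch, and by uniqueness the trajectory stays on the face.
\<close>

section \<open>Picard iteration and the saturated sine\<close>

text \<open>The initial value sits at the right end because every equation below is integrated back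
  from the end time. The Picard operator contracts with factor 1/2 in the supremum norm on intervals
  this short. The field may depend on time so that the adjoint equation, whose coefficients follow a
  given trajectory, is covered too.\<close>

lemma picard_backward:
  fixes f :: "real \<Rightarrow> 'a::banach \<Rightarrow> 'a"
  assumes "a \<le> b"
    and cont: "\<And>u. continuous_on {a..b} u \<Longrightarrow> continuous_on {a..b} (\<lambda>t. f t (u t))"
    and lip: "\<And>t x y. t \<in> {a..b} \<Longrightarrow> norm (f t x - f t y) \<le> L * norm (x - y)"
    and "0 \<le> L" "L * (b - a) \<le> 1 / 2"
  obtains u where "u b = x0"
    and "\<And>t. t \<in> {a..b} \<Longrightarrow> (u has_vector_derivative f t (u t)) (at t within {a..b})"
proof -
  define I where "I u t = integral {t..b} (\<lambda>s. f s (apply_bcontfun u s))" for u t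
  have contf: "continuous_on {a..b} (\<lambda>s. f s (apply_bcontfun u s))" for u
    by (intro cont) simp
  have int: "(\<lambda>s. f s (apply_bcontfun u s)) integrable_on {t..b}" if "t \<in> {a..b}" for u t
    using that by (intro integrable_continuous_real continuous_on_subset[OF contf]) auto
  have clamp: "clamp a b t \<in> {a..b}" for t
    using clamp_in_interval[of a b t] \<open>a \<le> b\<close> by simp
  \<comment> \<open>Extending the Picard image by constants outside the interval, via
    \<open>clamp\<close>, makes it a bounded continuous function on the line, so that Banach's
    theorem applies to the complete space of such functions.\<close>
  have "\<exists>v. \<forall>t. apply_bcontfun v t = x0 - I u (clamp a b t)" for u
  proof -
    have "continuous_on {a..b} (\<lambda>t. integral {t..b} (\<lambda>s. f s (apply_bcontfun u s)))"
      using \<open>a \<le> b\<close> by (intro indefinite_integral_continuous_1' int) auto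
    then have "continuous_on (cbox a b) (\<lambda>t. x0 - I u t)"
      unfolding I_def by (auto intro!: continuous_intros)
    then show ?thesis
      by (rule continuous_on_cbox_bcontfunE) blast
  qed
  then obtain T where T: "\<And>u t. apply_bcontfun (T u) t = x0 - I u (clamp a b t)"
    by metis
  have "dist (T u) (T v) \<le> 1 / 2 * dist u v" for u v
  proof (rule dist_bound)
    fix t
    define c where "c = clamp a b t"
    have c: "c \<in> {a..b}"
      using clamp by (simp add: c_def)
    have "dist (apply_bcontfun (T u) t) (apply_bcontfun (T v) t)
        = norm (integral {c..b} (\<lambda>s. f s (apply_bcontfun u s) - f s (apply_bcontfun v s)))"
      using int[OF c] by (simp add: T c_def[symmetric] I_def dist_norm integral_diff norm_minus_commute)
    also have "\<dots> \<le> integral {c..b} (\<lambda>s. L * dist u v)"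
    proof (rule integral_norm_bound_integral)
      show "(\<lambda>s. f s (apply_bcontfun u s) - f s (apply_bcontfun v s)) integrable_on {c..b}"
        using int[OF c] by (intro integrable_diff) auto
      show "norm (f s (apply_bcontfun u s) - f s (apply_bcontfun v s)) \<le> L * dist u v"
        if "s \<in> {c..b}" for s
        using lip[of s "apply_bcontfun u s" "apply_bcontfun v s"] that c \<open>0 \<le> L\<close>
          mult_left_mono[OF dist_bounded[of u s v] \<open>0 \<le> L\<close>]
        by (auto simp: dist_norm)
    qed auto
    also have "\<dots> = L * (b - c) * dist u v"
      using c by simp
    also have "\<dots> \<le> 1 / 2 * dist u v"
    proof (rule mult_right_mono)
      have "L * (b - c) \<le> L * (b - a)"
        using c \<open>0 \<le> L\<close> by (intro mult_left_mono) auto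
      then show "L * (b - c) \<le> 1 / 2"
        using assms by simp
    qed simp
    finally show "dist (apply_bcontfun (T u) t) (apply_bcontfun (T v) t) \<le> 1 / 2 * dist u v" .
  qed
  then obtain u where u: "T u = u"
    using banach_fix_type[of "1/2" T] by auto
  have sol: "apply_bcontfun u t = x0 - I u t" if "t \<in> {a..b}" for t
    using T[of u t] that by (simp add: u)
  show thesis
  proof
    show "apply_bcontfun u b = x0"
      using sol[of b] \<open>a \<le> b\<close> by (simp add: I_def)
    fix t assume t: "t \<in> {a..b}"
    let ?h = "\<lambda>s. f s (apply_bcontfun u s)"
    have "((\<lambda>s. x0 - integral {a..b} ?h + integral {a..s} ?h) has_vector_derivative ?h t)
        (at t within {a..b})"
      by (auto intro!: derivative_eq_intros integral_has_vector_derivative contf t)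
    \<comment> \<open>Moving the variable limit from the lower to the upper end of the integral puts
      the solution into the form to which the fundamental theorem applies.\<close>
    moreover have "apply_bcontfun u s = x0 - integral {a..b} ?h + integral {a..s} ?h"
      if "s \<in> {a..b}" for s
    proof -
      have "integral {a..b} ?h = integral {a..s} ?h + integral {s..b} ?h"
        using that int[of a u]
        by (intro Henstock_Kurzweil_Integration.integral_combine[symmetric]) auto
      then show ?thesis
        by (simp add: sol[OF that] I_def)
    qed
    ultimately show "(apply_bcontfun u has_vector_derivative ?h t) (at t within {a..b})"
      by (rule has_vector_derivative_transform[OF t, rotated])
  qed
qed

section \<open>Smoothness of the sine under saturation\<close>

lemma abs_sin_diff_le: "\<bar>sin x - sin y\<bar> \<le> \<bar>x - y\<bar>" for x y :: real
proof -
  have "norm (sin x - sin y) \<le> 1 * norm (x - y)"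
    by (rule field_differentiable_bound[of UNIV sin cos]) (auto intro!: derivative_eq_intros)
  then show ?thesis by simp
qed

lemma has_real_derivative_min_critical:
  assumes f: "\<And>y. (f has_real_derivative f' y) (at y)" and "f' q = 0"
  shows "((\<lambda>y. f (min y q)) has_real_derivative f' (min y q)) (at y)"
proof -
  consider "y < q" | "y = q" | "q < y" by linarith
  then show ?thesis
  proof cases
    case 1
    then have "(f has_real_derivative f' (min y q)) (at y)"
      using f[of y] by simp
    then show ?thesis
      by (rule has_field_derivative_transform_within_open[where S = "{..<q}"]) (use 1 in auto)
  next
    case 2
    have "((\<lambda>z. norm ((f z - f q) / (z - q))) \<longlongrightarrow> 0) (at q)"
      using f[of q] \<open>f' q = 0\<close> by (intro tendsto_norm_zero) (simp add: has_field_derivative_iff)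
    moreover have "\<forall>\<^sub>F z in at q. norm ((f (min z q) - f q) / (z - q)) \<le> norm ((f z - f q) / (z - q))"
      by (rule always_eventually) (simp add: min_def)
    ultimately have "((\<lambda>z. (f (min z q) - f q) / (z - q)) \<longlongrightarrow> 0) (at q)"
      by (rule Lim_null_comparison[rotated])
    then show ?thesis
      using 2 \<open>f' q = 0\<close> by (simp add: has_field_derivative_iff)
  next
    case 3
    then have "((\<lambda>_. f q) has_real_derivative f' (min y q)) (at y)"
      using \<open>f' q = 0\<close> by simp
    then show ?thesis
      by (rule has_field_derivative_transform_within_open[where S = "{q<..}"]) (use 3 in auto)
  qed
qed

text \<open>Reflection at the origin exchanges \<open>max\<close> with \<open>min\<close>.\<close>

lemma has_real_derivative_max_critical:
  assumes f: "\<And>y. (f has_real_derivative f' y) (at y)" and "f' q = 0"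
  shows "((\<lambda>y. f (max y q)) has_real_derivative f' (max y q)) (at y)"
proof -
  have g: "((\<lambda>y. f (- y)) has_real_derivative - f' (- y)) (at y)" for y
    using DERIV_chain'[OF DERIV_minus[OF DERIV_ident] f, of y UNIV] by simp
  have "((\<lambda>y. f (- min y (- q))) has_real_derivative - f' (- min y (- q))) (at y)" for y
    using has_real_derivative_min_critical[of "\<lambda>y. f (- y)" "\<lambda>y. - f' (- y)" "- q", OF g] \<open>f' q = 0\<close>
    by simp
  from DERIV_chain'[OF DERIV_minus[OF DERIV_ident] this, of y UNIV]
  show ?thesis by (simp add: minus_min_eq_max)
qed

text \<open>Saturation replaces the argument of the sine by a constant exactly where that constant is a
  critical point, so the disturbance may be treated as constant when differentiating.\<close>

lemma has_real_derivative_sin_minus_sat: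
  assumes "l \<le> u" "cos c = 0"
  shows "((\<lambda>y. sin (y - sat (y + c) u l)) has_real_derivative cos (y - sat (y + c) u l)) (at y)"
proof -
  have c: "cos (- c) = 0" using assms by simp
  have 1: "((\<lambda>y. sin (min (y - l) (- c))) has_real_derivative cos (min (y - l) (- c))) (at y)" for y
  proof -
    have "((\<lambda>y. y - l) has_real_derivative 1) (at y)"
      by (auto intro!: derivative_eq_intros)
    from DERIV_chain'[OF this has_real_derivative_min_critical[of sin cos, OF DERIV_sin c]]
    show ?thesis by simp
  qed
  have 2: "((\<lambda>y. sin (max (y - u) (- c))) has_real_derivative cos (max (y - u) (- c))) (at y)" for y
  proof -
    have "((\<lambda>y. y - u) has_real_derivative 1) (at y)"
      by (auto intro!: derivative_eq_intros)
    from DERIV_chain'[OF this has_real_derivative_max_critical[of sin cos, OF DERIV_sin c]]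
    show ?thesis by simp
  qed
  \<comment> \<open>The saturated argument is \<open>y - l\<close>, \<open>- c\<close> or
    \<open>y - u\<close>. Since \<open>l \<le> u\<close>, at most one of the clipped arguments
    differs from \<open>- c\<close>, so any function of the saturated argument splits into two
    one-sided clippings minus a constant.\<close>
  have "h (y - sat (y + c) u l) = h (min (y - l) (- c)) + h (max (y - u) (- c)) - h (- c)"
    for h :: "real \<Rightarrow> real" and y
  proof -
    consider "y + c < l" | "l \<le> y + c" "y + c \<le> u" | "u < y + c" by linarith
    then show ?thesis
    proof cases
      case 2
      then have "min (y - l) (- c) = - c" "max (y - u) (- c) = - c" by auto
      then show ?thesis using 2 by (simp add: sat_def)
    qed (use \<open>l \<le> u\<close> in \<open>simp_all add: sat_def min_def max_def\<close>)
  qed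
  from this[of sin] this[of cos] show ?thesis
    using DERIV_diff[OF DERIV_add[OF 1 2] DERIV_const[of "sin (- c)"], of y] c by simp
qed

section \<open>The two branches\<close>

text \<open>Only the sign of \<open>r\<close> matters. Freezing it separates the continuous
  dependence of the realisation on the angle from its jump when the second adjoint component changes
  sign.\<close>

definition branch_dist :: "('n, 'z) grid_scheme \<Rightarrow> safe_set \<Rightarrow> real \<Rightarrow> real \<Rightarrow> 'n \<Rightarrow> real" where
  "branch_dist g S r \<delta> j = sat (target_angle S \<delta> r) (ang_hi g j) (ang_lo g j)"

lemma dist_real_eq_branch_dist: "dist_real g S x lam t = branch_dist g S (snd (lam t)) (fst (x t))"
  by (simp add: fun_eq_iff dist_real_def branch_dist_def)

lemma target_angle_cong: "0 \<le> r \<longleftrightarrow> 0 \<le> q \<Longrightarrow> target_angle S \<delta> r = target_angle S \<delta> q"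
  by (cases S) auto

lemma branch_dist_cong: "0 \<le> r \<longleftrightarrow> 0 \<le> q \<Longrightarrow> branch_dist g S r = branch_dist g S q"
  by (simp add: fun_eq_iff branch_dist_def target_angle_cong[of r q])

lemma target_angle_offset:
  obtains c where "cos c = 0" "\<And>\<delta>. target_angle S \<delta> r = \<delta> + c"
proof (cases S; cases "0 \<le> r")
qed (use that[of "pi / 2"] that[of "- pi / 2"] in \<open>auto simp: cos_minus\<close>)

lemma branch_dist_Lipschitz: "\<bar>branch_dist g S r \<delta> j - branch_dist g S r \<epsilon> j\<bar> \<le> \<bar>\<delta> - \<epsilon>\<bar>"
proof -
  obtain c where "\<And>\<delta>. target_angle S \<delta> r = \<delta> + c"
    by (metis target_angle_offset)
  then show ?thesis
    by (auto simp: branch_dist_def sat_def max_def min_def)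
qed

lemma continuous_on_branch_dist [continuous_intros]:
  assumes "continuous_on A f"
  shows "continuous_on A (\<lambda>t. branch_dist g S r (f t) j)"
proof -
  obtain c where "\<And>\<delta>. target_angle S \<delta> r = \<delta> + c"
    by (metis target_angle_offset)
  then show ?thesis
    unfolding branch_dist_def sat_def by (auto intro!: continuous_intros assms)
qed

lemma has_real_derivative_sin_branch_dist:
  assumes "ang_lo g j \<le> ang_hi g j" "(f has_real_derivative f') (at t within A)"
  shows "((\<lambda>t. sin (f t - branch_dist g S r (f t) j)) has_real_derivative
      cos (f t - branch_dist g S r (f t) j) * f') (at t within A)"
proof -
  obtain c where "cos c = 0" "\<And>\<delta>. target_angle S \<delta> r = \<delta> + c"
    by (metis target_angle_offset)
  then show ?thesis
    using DERIV_chain'[OF assms(2) has_real_derivative_sin_minus_sat[OF assms(1), of c]]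
    by (simp add: branch_dist_def mult.commute)
qed

text \<open>One constant for both equations: a Lipschitz constant of either branch field and an
  operator bound for the linear adjoint field. The 1 comes from the unit coefficients in the two
  equations; the factor 2 arises because angle and saturated disturbance are each 1-Lipschitz in the
  angle and their difference enters the sine.\<close>

definition field_bound :: "('n, 'z) grid_scheme \<Rightarrow> 'n \<Rightarrow> real" where
  "field_bound g i = 1 + damping g i / mass g i + 2 * (\<Sum>j\<in>nbrs g i. coupling g i j / mass g i)"

lemma field_bound_ge_1:
  assumes "generator g i" shows "1 \<le> field_bound g i" "damping g i / mass g i \<le> field_bound g i"
proof -
  have "0 \<le> (\<Sum>j\<in>nbrs g i. coupling g i j / mass g i)" "0 \<le> damping g i / mass g i"
    using assms by (auto simp: generator_def intro!: sum_nonneg)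
  then show "1 \<le> field_bound g i" "damping g i / mass g i \<le> field_bound g i"
    by (auto simp: field_bound_def)
qed

section \<open>Norm estimates for the branch field and the adjoint field\<close>

lemma norm_pair_le: "norm (p :: real \<times> real) \<le> \<bar>fst p\<bar> + \<bar>snd p\<bar>"
  by (metis norm_Pair_le prod.collapse real_norm_def)

lemma abs_fst_le_norm: "\<bar>fst (p :: real \<times> real)\<bar> \<le> norm p"
  by (metis norm_fst_le prod.collapse real_norm_def)

lemma abs_snd_le_norm: "\<bar>snd (p :: real \<times> real)\<bar> \<le> norm p"
  by (metis norm_snd_le prod.collapse real_norm_def)

lemma dyn_branch_Lipschitz:
  fixes x y :: "real \<times> real"
  assumes "generator g i"
  shows "norm (dyn g i x (branch_dist g S r (fst x)) - dyn g i y (branch_dist g S r (fst y)))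
    \<le> field_bound g i * norm (x - y)"
proof -
  let ?s = "\<lambda>x j. sin (fst x - branch_dist g S r (fst x) j)"
  let ?m = "mass g i" and ?k = "damping g i" and ?c = "coupling g i"
  have m: "?m > 0" and k: "?k \<ge> 0" and c: "\<And>j. j \<in> nbrs g i \<Longrightarrow> ?c j \<ge> 0"
    using assms by (auto simp: generator_def)
  have s: "\<bar>?s x j - ?s y j\<bar> \<le> 2 * norm (x - y)" for j
    using abs_sin_diff_le[of "fst x - branch_dist g S r (fst x) j" "fst y - branch_dist g S r (fst y) j"]
      branch_dist_Lipschitz[of g S r "fst x" j "fst y"] abs_fst_le_norm[of "x - y"]
    by (simp add: abs_le_iff) linarith
  have "snd (dyn g i x (branch_dist g S r (fst x))) - snd (dyn g i y (branch_dist g S r (fst y)))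
      = - (?k / ?m * snd (x - y)) - (\<Sum>j\<in>nbrs g i. ?c j / ?m * (?s x j - ?s y j))"
    using m by (simp add: dyn_def sum_subtractf sum_divide_distrib diff_divide_distrib
        add_divide_distrib right_diff_distrib)
  also have "\<bar>\<dots>\<bar> \<le> \<bar>?k / ?m * snd (x - y)\<bar> + \<bar>\<Sum>j\<in>nbrs g i. ?c j / ?m * (?s x j - ?s y j)\<bar>"
    by linarith
  also have "\<dots> \<le> ?k / ?m * norm (x - y) + (\<Sum>j\<in>nbrs g i. ?c j / ?m * (2 * norm (x - y)))"
  proof (rule add_mono)
    show "\<bar>?k / ?m * snd (x - y)\<bar> \<le> ?k / ?m * norm (x - y)"
      using m k abs_snd_le_norm[of "x - y"]
      by (simp add: abs_mult divide_right_mono mult_left_mono)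
    show "\<bar>\<Sum>j\<in>nbrs g i. ?c j / ?m * (?s x j - ?s y j)\<bar> \<le> (\<Sum>j\<in>nbrs g i. ?c j / ?m * (2 * norm (x - y)))"
      using m c s by (intro order.trans[OF sum_abs] sum_mono)
        (simp add: abs_mult divide_right_mono mult_left_mono)
  qed
  finally have 2: "\<bar>snd (dyn g i x (branch_dist g S r (fst x)) - dyn g i y (branch_dist g S r (fst y)))\<bar>
      \<le> ?k / ?m * norm (x - y) + (\<Sum>j\<in>nbrs g i. ?c j / ?m * (2 * norm (x - y)))"
    by simp
  have 1: "\<bar>fst (dyn g i x (branch_dist g S r (fst x)) - dyn g i y (branch_dist g S r (fst y)))\<bar>
      \<le> norm (x - y)"
    using abs_snd_le_norm[of "x - y"] by (simp add: dyn_def)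
  have "(\<Sum>j\<in>nbrs g i. ?c j / ?m * (2 * norm (x - y))) = 2 * (\<Sum>j\<in>nbrs g i. ?c j / ?m) * norm (x - y)"
    by (simp add: sum_distrib_left sum_distrib_right mult_ac)
  with 1 2 norm_pair_le[of "dyn g i x (branch_dist g S r (fst x)) - dyn g i y (branch_dist g S r (fst y))"]
  show ?thesis
    by (simp add: field_bound_def algebra_simps)
qed

lemma adjoint_dyn_diff: "adjoint_dyn g i x d l - adjoint_dyn g i x d l' = adjoint_dyn g i x d (l - l')"
  by (simp add: adjoint_dyn_def right_diff_distrib)

lemma norm_adjoint_dyn_le:
  assumes "generator g i"
  shows "norm (adjoint_dyn g i x d l) \<le> field_bound g i * norm l"
proof -
  let ?m = "mass g i" and ?k = "damping g i" and ?c = "coupling g i"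
  have m: "?m > 0" and k: "?k \<ge> 0" and c: "\<And>j. j \<in> nbrs g i \<Longrightarrow> ?c j \<ge> 0"
    using assms by (auto simp: generator_def)
  have "\<bar>\<Sum>j\<in>nbrs g i. ?c j / ?m * cos (fst x - d j)\<bar> \<le> (\<Sum>j\<in>nbrs g i. ?c j / ?m * 1)"
    using m c by (intro order.trans[OF sum_abs] sum_mono)
      (simp add: abs_mult divide_right_mono mult_left_le)
  then have 1: "\<bar>fst (adjoint_dyn g i x d l)\<bar> \<le> (\<Sum>j\<in>nbrs g i. ?c j / ?m) * norm l"
    using abs_snd_le_norm[of l]
    by (auto simp: adjoint_dyn_def abs_mult intro!: mult_mono sum_nonneg m[THEN less_imp_le] c divide_nonneg_nonneg)
  have "\<bar>snd (adjoint_dyn g i x d l)\<bar> \<le> \<bar>fst l\<bar> + \<bar>?k / ?m * snd l\<bar>"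
    using abs_triangle_ineq[of "- fst l" "?k / ?m * snd l"] by (simp add: adjoint_dyn_def)
  also have "\<dots> \<le> norm l + ?k / ?m * norm l"
    using m k abs_snd_le_norm[of l] abs_fst_le_norm[of l]
    by (intro add_mono) (simp_all add: abs_mult divide_right_mono mult_left_mono)
  finally have 2: "\<bar>snd (adjoint_dyn g i x d l)\<bar> \<le> norm l + ?k / ?m * norm l" .
  have "0 \<le> (\<Sum>j\<in>nbrs g i. ?c j / ?m) * norm l"
    using m c by (auto intro!: sum_nonneg mult_nonneg_nonneg)
  with 1 2 norm_pair_le[of "adjoint_dyn g i x d l"] show ?thesis
    by (simp add: field_bound_def algebra_simps)
qed

text \<open>The bound is squared because two products must be small: \<open>field_bound\<close>
  times the step, which controls the change of the adjoint, and that product times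
  \<open>damping g i / mass g i\<close>, which controls the damping term in the second adjoint
  equation.\<close>

definition step_size :: "('n, 'z) grid_scheme \<Rightarrow> 'n \<Rightarrow> real" where
  "step_size g i = 1 / (4 * (field_bound g i)\<^sup>2)"

lemma step_size_bounds:
  assumes "generator g i"
  shows "0 < step_size g i" "field_bound g i * step_size g i \<le> 1 / 4"
    "damping g i / mass g i * (field_bound g i * step_size g i) \<le> 1 / 4"
proof -
  let ?L = "field_bound g i"
  note L = field_bound_ge_1[OF assms]
  have eq: "?L * step_size g i = 1 / 4 / ?L"
    using L by (simp add: step_size_def power2_eq_square)
  show "0 < step_size g i" "?L * step_size g i \<le> 1 / 4"
    using L unfolding eq by (auto simp: step_size_def field_simps)
  have "damping g i / mass g i * (1 / 4 / ?L) \<le> ?L * (1 / 4 / ?L)"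
    using L by (intro mult_right_mono) auto
  then show "damping g i / mass g i * (?L * step_size g i) \<le> 1 / 4"
    using L unfolding eq by simp
qed

text \<open>Read backwards from \<open>b\<close>: a slope of at most \<open>- c\<close> makes
  \<open>q\<close> grow at rate at least \<open>c\<close>. This is how the sign of a quantity before
  the end time is read off from the integrated equation.\<close>

lemma integral_lower_bound:
  fixes f q :: "real \<Rightarrow> real"
  assumes "a \<le> b" "(f has_integral (q b - q a)) {a..b}" "\<And>s. s \<in> {a..b} \<Longrightarrow> f s \<le> - c"
  shows "q b + c * (b - a) \<le> q a"
proof -
  have "q b - q a \<le> - c * (b - a)"
    using has_integral_le[OF assms(2), of "\<lambda>_. - c" "- c * (b - a)"] assms(3) 
      has_integral_const_real[of "- c" a b] \<open>a \<le> b\<close>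
    by (auto simp: mult.commute)
  then show ?thesis by simp
qed

text \<open>The state is solved first, then the adjoint equation, which is linear along it. Over one
  step the adjoint moves by at most a third of \<open>norm l0\<close>, so it cannot vanish. If
  \<open>snd l0 = 0\<close>, the slope of the second component stays close to
  \<open>- fst l0\<close>, so backwards in time that component takes the sign of
  \<open>fst l0\<close> and keeps it.\<close>

lemma branch_solution:
  fixes x0 l0 :: "real \<times> real"
  assumes gen: "generator g i" and ab: "a \<le> b" "b - a \<le> step_size g i" and "l0 \<noteq> 0"
  obtains x lam where "x b = x0" "lam b = l0"
    and "\<And>t. t \<in> {a..b} \<Longrightarrow>
      (x has_vector_derivative dyn g i (x t) (branch_dist g S r (fst (x t)))) (at t within {a..b})"
    and "\<And>t. t \<in> {a..b} \<Longrightarrow> (lam has_vector_derivative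
      adjoint_dyn g i (x t) (branch_dist g S r (fst (x t))) (lam t)) (at t within {a..b})"
    and "\<And>t. t \<in> {a..b} \<Longrightarrow> lam t \<noteq> 0"
    and "\<And>t. snd l0 = 0 \<Longrightarrow> t \<in> {a..<b} \<Longrightarrow> fst l0 * snd (lam t) > 0"
proof -
  let ?L = "field_bound g i" and ?m = "mass g i" and ?k = "damping g i"
  let ?d = "\<lambda>x. branch_dist g S r (fst x)"
  note L = field_bound_ge_1[OF gen] and \<tau> = step_size_bounds[OF gen]
  have m: "?m > 0" "?k \<ge> 0"
    using gen by (auto simp: generator_def)
  have Lab: "?L * (b - a) \<le> ?L * step_size g i"
    using L ab by (intro mult_left_mono) auto
  then have half: "?L * (b - a) \<le> 1 / 2" and quarter: "?L * (b - a) \<le> 1 / 4"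
    using \<tau> by auto
  obtain x where x: "x b = x0"
    "\<And>t. t \<in> {a..b} \<Longrightarrow> (x has_vector_derivative dyn g i (x t) (?d (x t))) (at t within {a..b})"
  proof (rule picard_backward[of a b "\<lambda>_ x. dyn g i x (?d x)" ?L x0])
    show "continuous_on {a..b} (\<lambda>t. dyn g i (u t) (?d (u t)))" if "continuous_on {a..b} u" for u
      unfolding dyn_def using m by (auto intro!: continuous_intros that)
    show "norm (dyn g i x (?d x) - dyn g i y (?d y)) \<le> ?L * norm (x - y)" for x y
      by (rule dyn_branch_Lipschitz[OF gen])
  qed (use ab L half in auto)
  have contx: "continuous_on {a..b} x"
    by (rule continuous_on_vector_derivative[OF x(2)])
  let ?A = "\<lambda>t. adjoint_dyn g i (x t) (?d (x t))"
  obtain lam where lam: "lam b = l0"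
    "\<And>t. t \<in> {a..b} \<Longrightarrow> (lam has_vector_derivative ?A t (lam t)) (at t within {a..b})"
  proof (rule picard_backward[of a b ?A ?L l0])
    show "continuous_on {a..b} (\<lambda>t. ?A t (u t))" if "continuous_on {a..b} u" for u
      unfolding adjoint_dyn_def using m by (auto intro!: continuous_intros that contx)
    show "norm (?A t l - ?A t l') \<le> ?L * norm (l - l')" for t l l'
      unfolding adjoint_dyn_diff by (rule norm_adjoint_dyn_le[OF gen])
  qed (use ab L half in auto)
  have contl: "continuous_on {a..b} lam"
    by (rule continuous_on_vector_derivative[OF lam(2)])
  have lam_int: "((\<lambda>s. ?A s (lam s)) has_integral (lam b - lam t)) {t..b}" if "t \<in> {a..b}" for t
    using that
    by (intro fundamental_theorem_of_calculus has_vector_derivative_within_subset[OF lam(2)]) auto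
  \<comment> \<open>The maximum \<open>?M\<close> of the adjoint norm replaces a Gronwall argument:
    the adjoint moves by at most \<open>?M / 4\<close>, whence \<open>?M\<close> is at most 4/3 of
    \<open>norm l0\<close>.\<close>
  obtain s where s: "s \<in> {a..b}" "\<And>t. t \<in> {a..b} \<Longrightarrow> norm (lam t) \<le> norm (lam s)"
    using continuous_attains_sup[OF compact_Icc _ continuous_on_norm[OF contl]] ab by auto
  let ?M = "norm (lam s)"
  have diff: "norm (l0 - lam t) \<le> ?L * (b - a) * ?M" if t: "t \<in> {a..b}" for t
  proof -
    have "norm (lam b - lam t) \<le> ?L * ?M * measure lborel {t..b}"
    proof (rule has_integral_bound_real[OF _ _ lam_int[OF t]])
      show "norm (?A s' (lam s')) \<le> ?L * ?M" if "s' \<in> {t..b} - {}" for s'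
        using that t L
        by (intro order.trans[OF norm_adjoint_dyn_le[OF gen]] mult_left_mono s(2)) auto
    qed (use L in auto)
    also have "\<dots> = ?L * (b - t) * ?M"
      using t by simp
    also have "\<dots> \<le> ?L * (b - a) * ?M"
      using t L by (intro mult_right_mono mult_left_mono) auto
    finally show ?thesis
      by (simp add: lam)
  qed
  have "norm (l0 - lam s) \<le> 1 / 4 * ?M"
    using diff[OF s(1)] mult_right_mono[OF quarter norm_ge_zero] by (rule order.trans)
  then have M: "?M \<le> 4 / 3 * norm l0"
    using norm_triangle_ineq4[of l0 "l0 - lam s"] by simp
  have diff': "norm (l0 - lam t) \<le> ?L * step_size g i * (4 / 3 * norm l0)" if "t \<in> {a..b}" for t
    using ab Lab M L \<tau>
    by (intro order.trans[OF diff[OF that]] mult_mono) auto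
  show thesis
  proof (rule that[OF x(1) lam(1) x(2) lam(2)])
    fix t assume t: "t \<in> {a..b}"
    have "norm (l0 - lam t) \<le> 1 / 4 * (4 / 3 * norm l0)"
      by (rule order.trans[OF diff'[OF t] mult_right_mono[OF \<tau>(2)]]) simp
    then show "lam t \<noteq> 0"
      using \<open>l0 \<noteq> 0\<close> by auto
  next
    fix t assume l0: "snd l0 = 0" and t: "t \<in> {a..<b}"
    define \<kappa> where "\<kappa> = ?k / ?m"
    let ?p = "fst l0"
    have "norm l0 = \<bar>?p\<bar>"
      using l0 by (cases l0) simp
    have p: "?p \<noteq> 0"
      using l0 \<open>l0 \<noteq> 0\<close> by (auto simp: prod_eq_iff)
    \<comment> \<open>Multiplying by \<open>?p\<close> treats both signs at once. The slope of
      \<open>?p * snd (lam t)\<close> would be \<open>- ?p * ?p\<close> for a constant adjoint; the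
      drift of the first component and the damping term each cost at most a third of that.\<close>
    have "?p * snd (lam b) + ?p\<^sup>2 / 3 * (b - t) \<le> ?p * snd (lam t)"
    proof (rule integral_lower_bound)
      show "((\<lambda>s. ?p * snd (?A s (lam s))) has_integral (?p * snd (lam b) - ?p * snd (lam t))) {t..b}"
        using has_integral_mult_right[OF has_integral_linear[OF lam_int bounded_linear_snd], of t ?p] t
        by (simp add: o_def right_diff_distrib)
      fix s assume s: "s \<in> {t..b}"
      then have s': "s \<in> {a..b}" using t by auto
      define e where "e = ?L * step_size g i * (4 / 3 * norm l0)"
      have e: "\<bar>?p - fst (lam s)\<bar> \<le> e" "\<bar>snd (lam s)\<bar> \<le> e"
        using abs_fst_le_norm[of "l0 - lam s"] abs_snd_le_norm[of "l0 - lam s"] diff'[OF s'] l0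
        by (auto simp: e_def)
      have "e \<le> \<bar>?p\<bar> / 3" "\<kappa> * e \<le> \<bar>?p\<bar> / 3"
        using mult_right_mono[OF \<tau>(2), of "4 / 3 * norm l0"] mult_right_mono[OF \<tau>(3), of "4 / 3 * norm l0"]
        by (auto simp: e_def \<kappa>_def \<open>norm l0 = \<bar>?p\<bar>\<close> mult.assoc)
      moreover have "\<bar>\<kappa> * snd (lam s)\<bar> \<le> \<kappa> * e"
        using e m by (auto simp: \<kappa>_def abs_mult divide_right_mono mult_left_mono)
      moreover have "snd (?A s (lam s)) = \<kappa> * snd (lam s) - fst (lam s)"
        by (simp add: adjoint_dyn_def \<kappa>_def)
      ultimately have "\<bar>?p + snd (?A s (lam s))\<bar> \<le> 2 / 3 * \<bar>?p\<bar>"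
        using e by linarith
      then have "\<bar>?p\<bar> * \<bar>?p + snd (?A s (lam s))\<bar> \<le> \<bar>?p\<bar> * (2 / 3 * \<bar>?p\<bar>)"
        by (intro mult_left_mono) auto
      then have "\<bar>?p * ?p + ?p * snd (?A s (lam s))\<bar> \<le> 2 / 3 * ?p\<^sup>2"
        by (simp add: abs_mult[symmetric] distrib_left power2_eq_square)
      then show "?p * snd (?A s (lam s)) \<le> - (?p\<^sup>2 / 3)"
        unfolding power2_eq_square by linarith
    qed (use t in auto)
    moreover have "0 < ?p\<^sup>2 / 3 * (b - t)"
      using p t by simp
    ultimately show "0 < fst l0 * snd (lam t)"
      using l0 lam(1) by simp
  qed
qed

text \<open>The adjoint field is minus the transposed Jacobian of the dynamics with the disturbance
  held constant. On a branch the sine terms are differentiated as if the disturbance were constant,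
  so the usual cancellation gives derivative zero although the disturbance varies with the
  angle.\<close>

lemma hamiltonian_branch_constant:
  assumes gen: "generator g i" and "a \<le> b"
    and x: "\<And>t. t \<in> {a..b} \<Longrightarrow>
      (x has_vector_derivative dyn g i (x t) (branch_dist g S r (fst (x t)))) (at t within {a..b})"
    and lam: "\<And>t. t \<in> {a..b} \<Longrightarrow> (lam has_vector_derivative
      adjoint_dyn g i (x t) (branch_dist g S r (fst (x t))) (lam t)) (at t within {a..b})"
    and t: "t \<in> {a..b}"
  shows "hamiltonian g i (x t) (lam t) (branch_dist g S r (fst (x t)))
    = hamiltonian g i (x b) (lam b) (branch_dist g S r (fst (x b)))"
proof -
  let ?d = "\<lambda>t. branch_dist g S r (fst (x t))"
  let ?H = "\<lambda>t. hamiltonian g i (x t) (lam t) (?d t)"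
  have m: "mass g i > 0" and lohi: "\<And>j. j \<in> nbrs g i \<Longrightarrow> ang_lo g j \<le> ang_hi g j"
    using gen by (auto simp: generator_def)
  have "(?H has_real_derivative 0) (at t within {a..b})" if t: "t \<in> {a..b}" for t
  proof -
    let ?F = "snd (dyn g i (x t) (?d t))" and ?A = "adjoint_dyn g i (x t) (?d t) (lam t)"
    let ?C = "\<Sum>j\<in>nbrs g i. coupling g i j * cos (fst (x t) - ?d t j)"
    have 1: "((\<lambda>t. fst (x t)) has_real_derivative snd (x t)) (at t within {a..b})"
      using bounded_linear.has_vector_derivative[OF bounded_linear_fst x[OF t]]
      by (simp add: has_real_derivative_iff_has_vector_derivative dyn_def)
    have 2: "((\<lambda>t. snd (x t)) has_real_derivative ?F) (at t within {a..b})"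
      using bounded_linear.has_vector_derivative[OF bounded_linear_snd x[OF t]]
      by (simp add: has_real_derivative_iff_has_vector_derivative)
    have 3: "((\<lambda>t. fst (lam t)) has_real_derivative fst ?A) (at t within {a..b})"
      using bounded_linear.has_vector_derivative[OF bounded_linear_fst lam[OF t]]
      by (simp add: has_real_derivative_iff_has_vector_derivative)
    have 4: "((\<lambda>t. snd (lam t)) has_real_derivative snd ?A) (at t within {a..b})"
      using bounded_linear.has_vector_derivative[OF bounded_linear_snd lam[OF t]]
      by (simp add: has_real_derivative_iff_has_vector_derivative)
    have "((\<lambda>t. \<Sum>j\<in>nbrs g i. coupling g i j * sin (fst (x t) - ?d t j)) has_real_derivative
        (\<Sum>j\<in>nbrs g i. coupling g i j * (cos (fst (x t) - ?d t j) * snd (x t)))) (at t within {a..b})"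
      by (intro DERIV_sum DERIV_cmult has_real_derivative_sin_branch_dist[OF lohi 1])
    then have 5: "((\<lambda>t. \<Sum>j\<in>nbrs g i. coupling g i j * sin (fst (x t) - ?d t j)) has_real_derivative
        ?C * snd (x t)) (at t within {a..b})"
      by (simp add: sum_distrib_right mult.assoc)
    have "((\<lambda>t. snd (dyn g i (x t) (?d t))) has_real_derivative
        (- damping g i * ?F - ?C * snd (x t)) / mass g i) (at t within {a..b})"
      using DERIV_cdivide[OF DERIV_add[OF DERIV_diff[OF DERIV_cmult[OF 2, of "- damping g i"] 5]
            DERIV_const[of "torque g i"]], of "mass g i"]
      by (simp add: dyn_def)
    from DERIV_add[OF DERIV_mult[OF 3 2] DERIV_mult[OF 4 this]]
    have "((\<lambda>t. fst (lam t) * snd (x t) + snd (lam t) * snd (dyn g i (x t) (?d t))) has_real_derivative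
        fst ?A * snd (x t) + ?F * fst (lam t)
        + (snd ?A * ?F + (- damping g i * ?F - ?C * snd (x t)) / mass g i * snd (lam t))) (at t within {a..b})"
      by simp
    moreover have "?A = (?C / mass g i * snd (lam t), - fst (lam t) + damping g i / mass g i * snd (lam t))"
      by (simp add: adjoint_dyn_def sum_divide_distrib)
    ultimately show ?thesis
      using m by (simp add: hamiltonian_def inner_prod_def field_simps) (simp add: dyn_def)
  qed
  then obtain c where "\<And>t. t \<in> {a..b} \<Longrightarrow> ?H t = c"
    using has_field_derivative_zero_constant[of "{a..b}" ?H] by auto
  then show ?thesis
    using t \<open>a \<le> b\<close> by simp
qed

section \<open>Existence of candidate trajectories\<close>

text \<open>The invariant of the backward construction. Beyond the integrated equations it records a
  nonzero adjoint and a vanishing Hamiltonian, which the next step back needs at its starting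
  point.\<close>

definition solves ::
  "('n, 'z) grid_scheme \<Rightarrow> 'n \<Rightarrow> safe_set \<Rightarrow> real \<Rightarrow> real
     \<Rightarrow> (real \<Rightarrow> real \<times> real) \<Rightarrow> (real \<Rightarrow> real \<times> real) \<Rightarrow> bool" where
  "solves g i S a b x lam \<longleftrightarrow> (\<forall>t\<in>{a..b}.
     ((\<lambda>s. dyn g i (x s) (dist_real g S x lam s)) has_integral (x b - x t)) {t..b} \<and>
     ((\<lambda>s. adjoint_dyn g i (x s) (dist_real g S x lam s) (lam s)) has_integral (lam b - lam t)) {t..b} \<and>
     lam t \<noteq> 0 \<and> hamiltonian g i (x t) (lam t) (dist_real g S x lam t) = 0)"

section \<open>Gluing solutions along the time axis\<close>

lemma solves_cong:
  assumes "\<And>t. t \<in> {a..b} \<Longrightarrow> x t = x' t" "\<And>t. t \<in> {a..b} \<Longrightarrow> lam t = lam' t"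
  shows "solves g i S a b x lam \<longleftrightarrow> solves g i S a b x' lam'"
  unfolding solves_def
proof (rule ball_cong[OF refl])
  fix t assume t: "t \<in> {a..b}"
  have b: "b \<in> {a..b}" using t by simp
  have "((\<lambda>s. dyn g i (x s) (dist_real g S x lam s)) has_integral (x b - x t)) {t..b} \<longleftrightarrow>
      ((\<lambda>s. dyn g i (x' s) (dist_real g S x' lam' s)) has_integral (x' b - x' t)) {t..b}"
    unfolding assms(1)[OF t] assms(1)[OF b]
    using assms t by (intro has_integral_cong) (simp add: dist_real_eq_branch_dist)
  moreover have "((\<lambda>s. adjoint_dyn g i (x s) (dist_real g S x lam s) (lam s)) has_integral (lam b - lam t)) {t..b}
      \<longleftrightarrow> ((\<lambda>s. adjoint_dyn g i (x' s) (dist_real g S x' lam' s) (lam' s)) has_integral (lam' b - lam' t)) {t..b}"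
    unfolding assms(2)[OF t] assms(2)[OF b]
    using assms t by (intro has_integral_cong) (simp add: dist_real_eq_branch_dist)
  ultimately show "(((\<lambda>s. dyn g i (x s) (dist_real g S x lam s)) has_integral (x b - x t)) {t..b} \<and>
      ((\<lambda>s. adjoint_dyn g i (x s) (dist_real g S x lam s) (lam s)) has_integral (lam b - lam t)) {t..b} \<and>
      lam t \<noteq> 0 \<and> hamiltonian g i (x t) (lam t) (dist_real g S x lam t) = 0) \<longleftrightarrow>
    (((\<lambda>s. dyn g i (x' s) (dist_real g S x' lam' s)) has_integral (x' b - x' t)) {t..b} \<and>
      ((\<lambda>s. adjoint_dyn g i (x' s) (dist_real g S x' lam' s) (lam' s)) has_integral (lam' b - lam' t)) {t..b} \<and>
      lam' t \<noteq> 0 \<and> hamiltonian g i (x' t) (lam' t) (dist_real g S x' lam' t) = 0)"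
    using assms t by (simp add: dist_real_eq_branch_dist)
qed

text \<open>Integrals over adjacent intervals add up, so the integrated form survives a junction at
  which the disturbance jumps and the derivative of the trajectory may be discontinuous.\<close>

lemma solves_append:
  assumes 1: "solves g i S a b x lam" and 2: "solves g i S b c x' lam'"
    and "b \<le> c" "x b = x' b" "lam b = lam' b"
  defines "X \<equiv> \<lambda>t. if t \<le> b then x t else x' t" and "Lam \<equiv> \<lambda>t. if t \<le> b then lam t else lam' t"
  shows "solves g i S a c X Lam"
proof -
  have A: "solves g i S a b X Lam"
    using 1 by (subst solves_cong[where x' = x and lam' = lam]) (auto simp: X_def Lam_def)
  have B: "solves g i S b c X Lam"
    using 2 by (subst solves_cong[where x' = x' and lam' = lam']) (auto simp: X_def Lam_def assms)
  have "t \<in> {a..b} \<or> t \<in> {b..c}" if "t \<in> {a..c}" for t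
    using that by auto
  moreover have "((\<lambda>s. dyn g i (X s) (dist_real g S X Lam s)) has_integral (X c - X t)) {t..c}"
    "((\<lambda>s. adjoint_dyn g i (X s) (dist_real g S X Lam s) (Lam s)) has_integral (Lam c - Lam t)) {t..c}"
    if "t \<in> {a..b}" for t
    using has_integral_combine[of t b c "\<lambda>s. dyn g i (X s) (dist_real g S X Lam s)" "X b - X t" "X c - X b"]
      has_integral_combine[of t b c "\<lambda>s. adjoint_dyn g i (X s) (dist_real g S X Lam s) (Lam s)"
        "Lam b - Lam t" "Lam c - Lam b"] A B that \<open>b \<le> c\<close>
    by (auto simp: solves_def)
  ultimately show ?thesis
    using A B unfolding solves_def by blast
qed

text \<open>The disturbance enters only the acceleration, which is weighted by \<open>snd l\<close>;
  hence the value of the Hamiltonian passes unchanged from one branch to the other.\<close>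

lemma hamiltonian_switch: "snd l = 0 \<Longrightarrow> hamiltonian g i x l d = hamiltonian g i x l d'"
  by (simp add: hamiltonian_def inner_prod_def dyn_def)

text \<open>Realisation and branch can differ only at the two end points, where the second adjoint
  component may vanish. A finite set does not affect the integrals, and at such a zero the
  Hamiltonian ignores the disturbance.\<close>

lemma solves_branch:
  assumes gen: "generator g i" and "a \<le> b"
    and x: "\<And>t. t \<in> {a..b} \<Longrightarrow>
      (x has_vector_derivative dyn g i (x t) (branch_dist g S r (fst (x t)))) (at t within {a..b})"
    and lam: "\<And>t. t \<in> {a..b} \<Longrightarrow> (lam has_vector_derivative
      adjoint_dyn g i (x t) (branch_dist g S r (fst (x t))) (lam t)) (at t within {a..b})"
    and nz: "\<And>t. t \<in> {a..b} \<Longrightarrow> lam t \<noteq> 0"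
    and sgn: "\<And>t. t \<in> {a..b} \<Longrightarrow> snd (lam t) \<noteq> 0 \<Longrightarrow> 0 \<le> snd (lam t) \<longleftrightarrow> 0 \<le> r"
    and zeros: "\<And>t. t \<in> {a<..<b} \<Longrightarrow> snd (lam t) \<noteq> 0"
    and H: "hamiltonian g i (x b) (lam b) (dist_real g S x lam b) = 0"
  shows "solves g i S a b x lam"
  unfolding solves_def
proof (intro ballI conjI)
  fix t assume t: "t \<in> {a..b}"
  have dist: "dist_real g S x lam s = branch_dist g S r (fst (x s))"
    if "s \<in> {a..b}" "snd (lam s) \<noteq> 0" for s
    unfolding dist_real_eq_branch_dist branch_dist_cong[OF sgn[OF that]] ..
  show "((\<lambda>s. dyn g i (x s) (dist_real g S x lam s)) has_integral (x b - x t)) {t..b}"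
  proof (rule has_integral_spike_finite[of "{a, b}"])
    show "((\<lambda>s. dyn g i (x s) (branch_dist g S r (fst (x s)))) has_integral (x b - x t)) {t..b}"
      using t by (intro fundamental_theorem_of_calculus has_vector_derivative_within_subset[OF x]) auto
  qed (use t in \<open>auto simp: dist zeros\<close>)
  show "((\<lambda>s. adjoint_dyn g i (x s) (dist_real g S x lam s) (lam s)) has_integral (lam b - lam t)) {t..b}"
  proof (rule has_integral_spike_finite[of "{a, b}"])
    show "((\<lambda>s. adjoint_dyn g i (x s) (branch_dist g S r (fst (x s))) (lam s))
        has_integral (lam b - lam t)) {t..b}"
      using t by (intro fundamental_theorem_of_calculus has_vector_derivative_within_subset[OF lam]) auto
  qed (use t in \<open>auto simp: dist zeros\<close>)
  show "lam t \<noteq> 0"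
    by (rule nz[OF t])
  have *: "hamiltonian g i (x s) (lam s) (dist_real g S x lam s)
      = hamiltonian g i (x s) (lam s) (branch_dist g S r (fst (x s)))" if "s \<in> {a..b}" for s
    using dist[OF that] hamiltonian_switch by metis
  show "hamiltonian g i (x t) (lam t) (dist_real g S x lam t) = 0"
    using hamiltonian_branch_constant[OF gen \<open>a \<le> b\<close> x lam t] H *[OF t] *[of b] \<open>a \<le> b\<close> by simp
qed

text \<open>Going back from a zero of the second adjoint component, its sign becomes that of
  \<open>fst l0\<close> throughout the step, so \<open>fst l0\<close> selects the branch to
  follow.\<close>

lemma solves_from_switch:
  assumes gen: "generator g i" and ab: "a \<le> b" "b - a \<le> step_size g i"
    and l0: "l0 \<noteq> 0" "snd l0 = 0" and H: "hamiltonian g i x0 l0 d = 0"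
  obtains x lam where "solves g i S a b x lam" "x b = x0" "lam b = l0"
proof -
  let ?r = "fst l0"
  obtain x lam where *: "x b = x0" "lam b = l0"
    "\<And>t. t \<in> {a..b} \<Longrightarrow>
      (x has_vector_derivative dyn g i (x t) (branch_dist g S ?r (fst (x t)))) (at t within {a..b})"
    "\<And>t. t \<in> {a..b} \<Longrightarrow> (lam has_vector_derivative
      adjoint_dyn g i (x t) (branch_dist g S ?r (fst (x t))) (lam t)) (at t within {a..b})"
    "\<And>t. t \<in> {a..b} \<Longrightarrow> lam t \<noteq> 0"
    "\<And>t. snd l0 = 0 \<Longrightarrow> t \<in> {a..<b} \<Longrightarrow> fst l0 * snd (lam t) > 0"
    by (rule branch_solution[OF gen ab l0(1), of x0 S ?r]) blast
  have pos: "fst l0 * snd (lam t) > 0" if "t \<in> {a..<b}" for t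
    using *(6) l0 that by blast
  have "solves g i S a b x lam"
  proof (rule solves_branch[OF gen ab(1) *(3,4,5)])
    show "0 \<le> snd (lam t) \<longleftrightarrow> 0 \<le> ?r" if "t \<in> {a..b}" "snd (lam t) \<noteq> 0" for t
    proof -
      have "t \<noteq> b" using that l0 *(2) by auto
      then show ?thesis
        using pos[of t] that by (auto simp: zero_less_mult_iff)
    qed
    show "snd (lam t) \<noteq> 0" if "t \<in> {a<..<b}" for t
      using pos[of t] that by auto
    show "hamiltonian g i (x b) (lam b) (dist_real g S x lam b) = 0"
      using H hamiltonian_switch[OF l0(2)] * by metis
  qed
  then show thesis
    using that * by blast
qed

text \<open>The step size is so small that the second adjoint component vanishes at most once.\<close>

lemma solves_step:
  assumes gen: "generator g i" and ab: "a \<le> b" "b - a \<le> step_size g i" and l0: "l0 \<noteq> 0"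
    and H: "hamiltonian g i x0 l0 (branch_dist g S (snd l0) (fst x0)) = 0"
  obtains x lam where "solves g i S a b x lam" "x b = x0" "lam b = l0"
proof (cases "snd l0 = 0")
  case True
  then show thesis
    using solves_from_switch[OF gen ab l0 _ H] that by metis
next
  case False
  note False' = False
  let ?r = "snd l0"
  obtain x lam where *: "x b = x0" "lam b = l0"
    "\<And>t. t \<in> {a..b} \<Longrightarrow>
      (x has_vector_derivative dyn g i (x t) (branch_dist g S ?r (fst (x t)))) (at t within {a..b})"
    "\<And>t. t \<in> {a..b} \<Longrightarrow> (lam has_vector_derivative
      adjoint_dyn g i (x t) (branch_dist g S ?r (fst (x t))) (lam t)) (at t within {a..b})"
    "\<And>t. t \<in> {a..b} \<Longrightarrow> lam t \<noteq> 0"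
    by (rule branch_solution[OF gen ab l0(1), of x0 S ?r]) blast
  let ?Z = "{t \<in> {a..b}. snd (lam t) = 0}"
  have cont: "continuous_on {a..b} (\<lambda>t. snd (lam t))"
    by (intro continuous_on_snd continuous_on_vector_derivative[OF *(4)])
  have sgn: "snd (lam t) \<noteq> 0 \<and> (0 \<le> snd (lam t) \<longleftrightarrow> 0 \<le> ?r)" if "a \<le> t" "t \<le> b" "{t..b} \<inter> ?Z = {}" for t
  proof -
    have "continuous_on {t..b} (\<lambda>t. snd (lam t))"
      using cont by (rule continuous_on_subset) (use that in auto)
    moreover have "snd (lam u) \<noteq> 0" if "t \<le> u" "u \<le> b" for u
      using that \<open>a \<le> t\<close> \<open>{t..b} \<inter> ?Z = {}\<close> by auto
    ultimately have "\<not> (snd (lam t) \<le> 0 \<and> 0 \<le> snd (lam b))" "\<not> (snd (lam b) \<le> 0 \<and> 0 \<le> snd (lam t))"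
      using IVT'[of "\<lambda>t. snd (lam t)" t 0 b] IVT2'[of "\<lambda>t. snd (lam t)" b 0 t] that by metis+
    then show ?thesis
      using * False by auto
  qed
  have Hb: "hamiltonian g i (x b) (lam b) (dist_real g S x lam b) = 0"
    using H * by (simp add: dist_real_eq_branch_dist)
  \<comment> \<open>The left end \<open>c\<close> may itself be a zero, as
    \<open>solves_branch\<close> excludes zeros only from the open interval.\<close>
  have sub: "solves g i S c b x lam" if c: "a \<le> c" "c \<le> b" "{c<..b} \<inter> ?Z = {}" for c
  proof (rule solves_branch[OF gen c(2), where r = ?r])
    fix t assume t: "t \<in> {c..b}"
    show "(x has_vector_derivative dyn g i (x t) (branch_dist g S ?r (fst (x t)))) (at t within {c..b})"
      using t c by (intro has_vector_derivative_within_subset[OF *(3)]) auto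
    show "(lam has_vector_derivative
        adjoint_dyn g i (x t) (branch_dist g S ?r (fst (x t))) (lam t)) (at t within {c..b})"
      using t c by (intro has_vector_derivative_within_subset[OF *(4)]) auto
    show "lam t \<noteq> 0"
      using t c * by auto
    assume nz: "snd (lam t) \<noteq> 0"
    then have "{t..b} \<inter> ?Z = {}"
      using t c by (force simp: disjoint_iff le_less)
    then show "0 \<le> snd (lam t) \<longleftrightarrow> 0 \<le> ?r"
      using sgn[of t] t c by auto
  next
    show "snd (lam t) \<noteq> 0" if "t \<in> {c<..<b}" for t
    proof
      assume "snd (lam t) = 0"
      then have "t \<in> {c<..b} \<inter> ?Z" using that c(1,2) by simp
      then show False using c(3) by blast
    qed
  qed (rule Hb)
  show thesis
  proof (cases "?Z = {}")
    case True
    then have "{a<..b} \<inter> ?Z = {}" by blast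
    from sub[OF order.refl ab(1) this] show thesis
      using that * by blast
  next
    case False
    have "compact ?Z"
      using continuous_closed_preimage[OF cont, of "{0}"]
      by (auto simp: compact_eq_bounded_closed vimage_def Int_def intro: bounded_subset[of "{a..b}"])
    \<comment> \<open>The last zero in the interval is the first one met backwards. The branch of
      \<open>snd l0\<close> is kept to the right of \<open>s\<close>; what it does further left is
      discarded and replaced by a solution restarted at the switch.\<close>
    then obtain s where s: "s \<in> ?Z" "\<And>t. t \<in> ?Z \<Longrightarrow> t \<le> s"
      using compact_attains_sup[of ?Z] False by blast
    have "{s<..b} \<inter> ?Z = {}"
      using s(2) by force
    then have 2: "solves g i S s b x lam"
      using s(1) by (intro sub) auto
    then have Hs: "hamiltonian g i (x s) (lam s) (dist_real g S x lam s) = 0" "lam s \<noteq> 0"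
      using s(1) by (auto simp: solves_def)
    obtain y mu where y: "solves g i S a s y mu" "y s = x s" "mu s = lam s"
      by (rule solves_from_switch[OF gen _ _ Hs(2) _ Hs(1), of a s S]) (use s(1) ab in auto)
    have "s \<noteq> b"
      using s(1) * False' by auto
    then show thesis
      using that[OF solves_append[OF y(1) 2 _ y(2,3)]] s(1) * by auto
  qed
qed

text \<open>Steps of one fixed length exhaust the half-line. Each extension leaves the part already
  built untouched, so the chain of partial solutions has a common extension, independent of
  \<open>a\<close>.\<close>

lemma solves_exists:
  assumes gen: "generator g i" and l0: "l0 \<noteq> 0"
    and H: "hamiltonian g i x0 l0 (branch_dist g S (snd l0) (fst x0)) = 0"
  obtains x lam where "x b = x0" "lam b = l0" "\<And>a. a \<le> b \<Longrightarrow> solves g i S a b x lam"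
proof -
  define \<tau> where "\<tau> = step_size g i"
  have \<tau>: "0 < \<tau>"
    using step_size_bounds[OF gen] by (simp add: \<tau>_def)
  define P where "P n Y \<longleftrightarrow> solves g i S (b - real n * \<tau>) b (fst Y) (snd Y) \<and> fst Y b = x0 \<and> snd Y b = l0"
    for n and Y :: "(real \<Rightarrow> real \<times> real) \<times> (real \<Rightarrow> real \<times> real)"
  define Q where "Q n Y Y' \<longleftrightarrow> (\<forall>t\<ge>b - real n * \<tau>. fst Y' t = fst Y t \<and> snd Y' t = snd Y t)"
    for n :: nat and Y Y' :: "(real \<Rightarrow> real \<times> real) \<times> (real \<Rightarrow> real \<times> real)"
  have "\<exists>Y. \<forall>n. P n (Y n) \<and> Q n (Y n) (Y (Suc n))"
  proof (rule dependent_nat_choice)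
    have "P 0 (\<lambda>_. x0, \<lambda>_. l0)"
      using l0 H by (simp add: P_def solves_def dist_real_eq_branch_dist has_integral_refl)
    then show "\<exists>Y. P 0 Y" ..
  next
    fix Y n assume P: "P n Y"
    obtain x lam where Y: "Y = (x, lam)" by (cases Y)
    define c where "c = b - real n * \<tau>"
    have Pc: "solves g i S c b x lam" "x b = x0" "lam b = l0"
      using P by (auto simp: P_def Y c_def)
    have cb: "c \<le> b"
      using \<tau> by (simp add: c_def)
    then have "lam c \<noteq> 0" "hamiltonian g i (x c) (lam c) (branch_dist g S (snd (lam c)) (fst (x c))) = 0"
      using Pc by (auto simp: solves_def dist_real_eq_branch_dist)
    then obtain y mu where y: "solves g i S (c - \<tau>) c y mu" "y c = x c" "mu c = lam c"
      using solves_step[OF gen, of "c - \<tau>" c "lam c" "x c" S] \<tau> by (auto simp: \<tau>_def)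
    let ?Y' = "(\<lambda>t. if t \<le> c then y t else x t, \<lambda>t. if t \<le> c then mu t else lam t)"
    have "solves g i S (c - \<tau>) b (fst ?Y') (snd ?Y')"
      using solves_append[OF y(1) Pc(1) cb y(2,3)] by simp
    moreover have "c - \<tau> = b - real (Suc n) * \<tau>"
      by (simp add: c_def algebra_simps)
    moreover have "fst ?Y' b = x0" "snd ?Y' b = l0"
      using cb Pc y by (cases "b = c"; simp)+
    ultimately have "P (Suc n) ?Y'"
      by (simp add: P_def)
    moreover have "Q n Y ?Y'"
      using y by (auto simp: Q_def Y c_def[symmetric])
    ultimately show "\<exists>Y'. P (Suc n) Y' \<and> Q n Y Y'" by blast
  qed
  then obtain Y where Y: "\<And>n. P n (Y n)" "\<And>n. Q n (Y n) (Y (Suc n))"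
    by blast
  have stable: "fst (Y m) t = fst (Y n) t \<and> snd (Y m) t = snd (Y n) t"
    if "n \<le> m" "b - real n * \<tau> \<le> t" for m n t
    using that(1)
  proof (induction m rule: dec_induct)
    case (step m)
    have "real n * \<tau> \<le> real m * \<tau>"
      using step \<tau> by (intro mult_right_mono) auto
    then show ?case
      using Y(2)[of m] step that(2) by (simp add: Q_def)
  qed simp
  \<comment> \<open>After \<open>N t\<close> steps back from \<open>b\<close> the chain covers
    \<open>t\<close>, and later extensions no longer change its value there.\<close>
  define N where "N t = nat \<lceil>(b - t) / \<tau>\<rceil>" for t
  have N: "b - real (N t) * \<tau> \<le> t" for t
  proof -
    have "(b - t) / \<tau> \<le> real (N t)"
      unfolding N_def by linarith
    then show ?thesis
      using \<tau> by (simp add: field_simps)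
  qed
  define x lam where "x t = fst (Y (N t)) t" and "lam t = snd (Y (N t)) t" for t
  have eq: "x t = fst (Y n) t" "lam t = snd (Y n) t" if "b - real n * \<tau> \<le> t" for n t
    using stable[of "N t" n t, OF _ N] stable[of n "N t" t, OF _ that]
    unfolding x_def lam_def by (metis nle_le)+
  show thesis
  proof
    show "x b = x0" "lam b = l0"
      using eq[of 0 b] Y(1)[of 0] by (auto simp: P_def)
    fix a assume "a \<le> b"
    let ?n = "N a"
    have "solves g i S (b - real ?n * \<tau>) b x lam \<longleftrightarrow> solves g i S (b - real ?n * \<tau>) b (fst (Y ?n)) (snd (Y ?n))"
      by (rule solves_cong) (auto simp: eq)
    then have "solves g i S (b - real ?n * \<tau>) b x lam"
      using Y(1) by (simp add: P_def)
    then show "solves g i S a b x lam"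
      using N[of a] by (auto simp: solves_def)
  qed
qed

section \<open>Optimality of the saturated disturbance\<close>

lemma sat_nearest:
  assumes "l \<le> u" "e \<in> {l..u}"
  shows "\<bar>sat v u l - v\<bar> \<le> \<bar>e - v\<bar>"
  using assms by (auto simp: sat_def max_def min_def)

text \<open>A shift by a quarter turn makes each disturbance term a cosine of the distance to the
  target angle. The sign of its weight says whether that cosine helps to maximise or to
  minimise.\<close>

lemma snd_mult_sin_eq_cos_target:
  "r * sin (e - \<delta>) = (if S = MRPI then \<bar>r\<bar> else - \<bar>r\<bar>) * cos (e - target_angle S \<delta> r)"
proof -
  have "cos (e - (\<delta> + pi / 2)) = sin (e - \<delta>)" "cos (e - (\<delta> - pi / 2)) = - sin (e - \<delta>)"
    using cos_diff[of "e - \<delta>" "pi / 2"] cos_add[of "e - \<delta>" "pi / 2"] by (simp_all add: algebra_simps)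
  then show ?thesis
    by (cases S) auto
qed

lemma branch_dist_in_disturbances: "generator g i \<Longrightarrow> branch_dist g S r \<delta> \<in> disturbances g i"
  by (auto simp: generator_def disturbances_def branch_dist_def sat_def max_def min_def)

text \<open>The Hamiltonian separates over the neighbours. The cosine decreases on
  \<open>{0..pi}\<close>, so within half a turn the nearest admissible value maximises each term;
  for the admissible set the negative weight turns this into a minimum.\<close>

lemma extremal_branch_dist:
  assumes gen: "generator g i" and near: "within_half_turn g i S (fst x) (snd l)"
  shows "extremal S (hamiltonian g i x l) (disturbances g i) (branch_dist g S (snd l) (fst x))"
proof -
  let ?D = "disturbances g i" and ?b = "branch_dist g S (snd l) (fst x)" and ?H = "hamiltonian g i x l"
  let ?v = "target_angle S (fst x) (snd l)" and ?w = "if S = MRPI then \<bar>snd l\<bar> else - \<bar>snd l\<bar>"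
  let ?c = "\<lambda>d. \<Sum>j\<in>nbrs g i. coupling g i j / mass g i * cos (d j - ?v)"
  have m: "mass g i > 0" and c: "\<And>j. j \<in> nbrs g i \<Longrightarrow> coupling g i j \<ge> 0"
    using gen by (auto simp: generator_def)
  have H: "?H d = fst l * snd x + snd l * ((- damping g i * snd x + torque g i) / mass g i) + ?w * ?c d" for d
  proof -
    have "- snd l * (\<Sum>j\<in>nbrs g i. coupling g i j * sin (fst x - d j)) / mass g i
        = (\<Sum>j\<in>nbrs g i. coupling g i j / mass g i * (snd l * sin (d j - fst x)))"
      unfolding sum_distrib_left sum_divide_distrib
    proof (rule sum.cong[OF refl])
      fix j
      have "sin (d j - fst x) = - sin (fst x - d j)"
        using sin_minus[of "fst x - d j"] by simp
      then show "- snd l * (coupling g i j * sin (fst x - d j)) / mass g i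
          = coupling g i j / mass g i * (snd l * sin (d j - fst x))"
        by simp
    qed
    also have "\<dots> = ?w * ?c d"
      unfolding snd_mult_sin_eq_cos_target[of "snd l" _ _ S] sum_distrib_left
      by (rule sum.cong) (simp_all add: mult_ac)
    finally have "?w * ?c d = - snd l * (\<Sum>j\<in>nbrs g i. coupling g i j * sin (fst x - d j)) / mass g i" ..
    then show ?thesis
      using m by (simp add: hamiltonian_def inner_prod_def dyn_def field_simps)
  qed
  have best: "?c d \<le> ?c ?b" if d: "d \<in> ?D" for d
  proof (intro sum_mono mult_left_mono)
    fix j assume j: "j \<in> nbrs g i"
    have "\<bar>?b j - ?v\<bar> \<le> \<bar>d j - ?v\<bar>"
      using d j gen unfolding branch_dist_def by (intro sat_nearest) (auto simp: generator_def disturbances_def)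
    moreover have "\<bar>d j - ?v\<bar> \<le> pi"
      using near d j by (auto simp: within_half_turn_def disturbances_def)
    ultimately have "cos \<bar>d j - ?v\<bar> \<le> cos \<bar>?b j - ?v\<bar>"
      by (intro cos_monotone_0_pi_le) auto
    then show "cos (d j - ?v) \<le> cos (?b j - ?v)"
      by simp
    show "0 \<le> coupling g i j / mass g i"
      using m c j by simp
  qed
  have "?b \<in> ?D"
    by (rule branch_dist_in_disturbances[OF gen])
  show ?thesis
  proof (cases S)
    case MRPI
    then have "?H d \<le> ?H ?b" if "d \<in> ?D" for d
      unfolding H using mult_left_mono[OF best[OF that], of "\<bar>snd l\<bar>"] by simp
    then show ?thesis
      using MRPI \<open>?b \<in> ?D\<close> by (simp add: is_arg_max_def not_less)
  next
    case Admissible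
    then have "?H ?b \<le> ?H d" if "d \<in> ?D" for d
      unfolding H using mult_left_mono[OF best[OF that], of "\<bar>snd l\<bar>"] by simp
    then show ?thesis
      using Admissible \<open>?b \<in> ?D\<close> by (simp add: is_arg_min_def not_less)
  qed
qed

lemma candidate_exists:
  assumes gen: "generator g i"
  shows "\<exists>x lam. candidate g i S F tb x lam"
proof -
  let ?z = "tangency_point g i F" and ?l = "constraint_gradient F"
  \<comment> \<open>At the end point the gradient sees only the angular velocity, which is zero, so
    the Hamiltonian vanishes for every disturbance.\<close>
  have "?l \<noteq> 0" "hamiltonian g i ?z ?l (branch_dist g S (snd ?l) (fst ?z)) = 0"
    by (cases F; simp add: hamiltonian_def inner_prod_def dyn_def zero_prod_def)+
  then obtain x lam where *: "x tb = ?z" "lam tb = ?l" "\<And>a. a \<le> tb \<Longrightarrow> solves g i S a tb x lam"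
    using solves_exists[OF gen] by metis
  have "candidate g i S F tb x lam"
    unfolding candidate_def
  proof (intro conjI allI impI AE_I2)
    fix t assume "t \<le> tb"
    with *(3)[OF this] show
      "((\<lambda>s. dyn g i (x s) (dist_real g S x lam s)) has_integral (x tb - x t)) {t..tb}"
      "((\<lambda>s. adjoint_dyn g i (x s) (dist_real g S x lam s) (lam s)) has_integral (lam tb - lam t)) {t..tb}"
      "hamiltonian g i (x t) (lam t) (dist_real g S x lam t) = 0"
      by (auto simp: solves_def)
  next
    fix t assume "within_half_turn g i S (fst (x t)) (snd (lam t))"
    then show "extremal S (hamiltonian g i (x t) (lam t)) (disturbances g i) (dist_real g S x lam t)"
      using extremal_branch_dist[OF gen] by (simp add: dist_real_eq_branch_dist)
  qed (fact *)+
  then show ?thesis by blast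
qed

section \<open>Behaviour at the end point\<close>

lemma candidateD:
  assumes "candidate g i S F tb x lam" "t \<le> tb"
  shows "((\<lambda>s. dyn g i (x s) (dist_real g S x lam s)) has_integral (x tb - x t)) {t..tb}"
    and "((\<lambda>s. adjoint_dyn g i (x s) (dist_real g S x lam s) (lam s)) has_integral (lam tb - lam t)) {t..tb}"
  using assms by (auto simp: candidate_def)

section \<open>Limits of state and adjoint at the end time\<close>

lemma continuous_on_if_has_integral:
  fixes x :: "real \<Rightarrow> 'a::banach"
  assumes "\<And>t. t \<in> {a..b} \<Longrightarrow> (f has_integral (x b - x t)) {t..b}" "a \<le> b"
  shows "continuous_on {a..b} x"
proof -
  have "f integrable_on {a..b}"
    using assms by (auto intro: has_integral_integrable)
  then have "continuous_on {a..b} (\<lambda>t. x b - integral {t..b} f)"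
    by (intro continuous_intros indefinite_integral_continuous_1')
  moreover have "x b - integral {t..b} f = x t" if "t \<in> {a..b}" for t
    using integral_unique[OF assms(1)[OF that]] by simp
  ultimately show ?thesis
    by (rule continuous_on_eq)
qed

lemma candidate_tendsto:
  assumes "candidate g i S F tb x lam"
  shows "(x \<longlongrightarrow> x tb) (at_left tb)" "(lam \<longlongrightarrow> lam tb) (at_left tb)"
proof -
  have "continuous_on {tb - 1..tb} x" "continuous_on {tb - 1..tb} lam"
    by (auto intro!: continuous_on_if_has_integral candidateD[OF assms])
  then have "(x \<longlongrightarrow> x tb) (at tb within {tb - 1..tb})" "(lam \<longlongrightarrow> lam tb) (at tb within {tb - 1..tb})"
    by (auto simp: continuous_on_def)
  then show "(x \<longlongrightarrow> x tb) (at_left tb)" "(lam \<longlongrightarrow> lam tb) (at_left tb)"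
    using at_within_Icc_at_left[of "tb - 1" tb] by auto
qed

lemma eventually_at_left_Icc:
  fixes b :: real
  assumes "eventually P (at_left b)" "P b"
  obtains a where "a < b" "\<And>t. t \<in> {a..b} \<Longrightarrow> P t"
proof -
  obtain a where a: "a < b" "\<And>t. a < t \<Longrightarrow> t < b \<Longrightarrow> P t"
    using assms(1) by (auto simp: eventually_at_left_field)
  show thesis
    by (rule that[of "(a + b) / 2"]) (use a assms(2) in \<open>auto simp: field_simps le_less\<close>)
qed

text \<open>For an arbitrary candidate, the slope of the second adjoint component tends to minus the
  first entry of the gradient while the component itself vanishes at \<open>tb\<close>. Just before
  \<open>tb\<close> it therefore has the sign of that entry; the threshold 1/2 is any margin below
  the limiting slope 1.\<close>

lemma candidate_branch:
  assumes "candidate g i S F tb x lam"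
  obtains a where "a < tb"
    "\<And>t. t \<in> {a..<tb} \<Longrightarrow> fst (constraint_gradient F) * snd (lam t) > 0"
proof -
  let ?\<rho> = "fst (constraint_gradient F)" and ?\<kappa> = "damping g i / mass g i"
  have \<rho>: "?\<rho> * ?\<rho> = 1" and lb: "lam tb = (?\<rho>, 0)"
    using assms by (cases F; simp add: candidate_def)+
  let ?f = "\<lambda>t. ?\<rho> * (- fst (lam t) + ?\<kappa> * snd (lam t))"
  have "(?f \<longlongrightarrow> ?f tb) (at_left tb)"
    by (intro tendsto_intros candidate_tendsto[OF assms])
  moreover have fb: "?f tb = - 1"
    using \<rho> by (simp add: lb)
  ultimately have "\<forall>\<^sub>F t in at_left tb. ?f t < - (1 / 2)"
    by (intro order_tendstoD) auto
  then obtain a where a: "a < tb" "\<And>t. t \<in> {a..tb} \<Longrightarrow> ?f t < - (1 / 2)"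
    using fb by (elim eventually_at_left_Icc) auto
  have "?\<rho> * snd (lam t) > 0" if t: "t \<in> {a..<tb}" for t
  proof -
    have "?\<rho> * snd (lam tb) + 1 / 2 * (tb - t) \<le> ?\<rho> * snd (lam t)"
    proof (rule integral_lower_bound[where f = ?f])
      have "((\<lambda>s. snd (adjoint_dyn g i (x s) (dist_real g S x lam s) (lam s))) has_integral snd (lam tb - lam t)) {t..tb}"
        using has_integral_linear[OF candidateD(2)[OF assms] bounded_linear_snd] t by (simp add: o_def)
      from has_integral_mult_right[OF this, of ?\<rho>]
      show "(?f has_integral ?\<rho> * snd (lam tb) - ?\<rho> * snd (lam t)) {t..tb}"
        by (simp add: adjoint_dyn_def right_diff_distrib)
      show "?f s \<le> - (1 / 2)" if "s \<in> {t..tb}" for s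
        using a(2)[of s] t that by auto
    qed (use t in auto)
    then show ?thesis
      using t lb by simp
  qed
  then show thesis
    using that a by blast
qed

text \<open>The branch used before \<open>tb\<close> is continuous in the angle, so the one-sided
  limit can be evaluated at the end point. The result depends only on the face and the kind of set,
  not on the candidate.\<close>

lemma candidate_end_dist:
  assumes "candidate g i S F tb x lam"
  shows "end_dist g S x lam tb j
    = branch_dist g S (fst (constraint_gradient F)) (fst (tangency_point g i F)) j"
proof -
  let ?\<rho> = "fst (constraint_gradient F)"
  obtain a where a: "a < tb" "\<And>t. t \<in> {a..<tb} \<Longrightarrow> ?\<rho> * snd (lam t) > 0"
    using candidate_branch[OF assms] by blast
  have "continuous_on UNIV (\<lambda>\<delta>. branch_dist g S ?\<rho> \<delta> j)"
    by (intro continuous_intros)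
  then have "isCont (\<lambda>\<delta>. branch_dist g S ?\<rho> \<delta> j) (fst (x tb))"
    by (simp add: continuous_on_eq_continuous_at)
  from isCont_tendsto_compose[OF this tendsto_fst[OF candidate_tendsto(1)[OF assms]]]
  have "((\<lambda>t. branch_dist g S ?\<rho> (fst (x t)) j) \<longlongrightarrow> branch_dist g S ?\<rho> (fst (x tb)) j) (at_left tb)" .
  moreover have "\<forall>\<^sub>F t in at_left tb. branch_dist g S ?\<rho> (fst (x t)) j = dist_real g S x lam t j"
    unfolding eventually_at_left_field
  proof (intro exI[of _ a] conjI allI impI)
    fix t assume "a < t" "t < tb"
    then have "0 \<le> ?\<rho> \<longleftrightarrow> 0 \<le> snd (lam t)"
      using a(2)[of t] by (auto simp: zero_less_mult_iff)
    then show "branch_dist g S ?\<rho> (fst (x t)) j = dist_real g S x lam t j"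
      unfolding dist_real_eq_branch_dist by (rule fun_cong[OF fun_cong[OF branch_dist_cong]])
  qed (rule a(1))
  ultimately have "((\<lambda>t. dist_real g S x lam t j) \<longlongrightarrow> branch_dist g S ?\<rho> (fst (x tb)) j) (at_left tb)"
    by (rule Lim_transform_eventually)
  then have "end_dist g S x lam tb j = branch_dist g S ?\<rho> (fst (x tb)) j"
    unfolding end_dist_def by (intro tendsto_Lim) auto
  then show ?thesis
    using assms by (simp add: candidate_def)
qed

text \<open>The acceleration towards the outside of the constraint set, on the branch that the
  realisation uses just before the end time.\<close>

definition end_acceleration :: "('n, 'z) grid_scheme \<Rightarrow> 'n \<Rightarrow> safe_set \<Rightarrow> face \<Rightarrow> real" where
  "end_acceleration g i S F = fst (constraint_gradient F) * snd (dyn g i (tangency_point g i F)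
     (branch_dist g S (fst (constraint_gradient F)) (fst (tangency_point g i F))))"

text \<open>Near the end time, the angle has a strict one-sided extremum if the acceleration is nonzero;
  otherwise the end point is an equilibrium of the branch field and uniqueness applies.\<close>

lemma candidate_near_end:
  assumes gen: "generator g i" and cand: "candidate g i S F tb x lam"
  obtains a where "a < tb"
    "\<And>t. t \<in> {a..<tb} \<Longrightarrow> sgn (fst (constraint_gradient F) * (fst (x t) - fst (tangency_point g i F)))
      = sgn (end_acceleration g i S F)"
proof -
  let ?\<rho> = "fst (constraint_gradient F)" and ?z = "tangency_point g i F"
  let ?E = "end_acceleration g i S F" and ?L = "field_bound g i"
  define f where "f y = dyn g i y (branch_dist g S ?\<rho> (fst y))" for y
  have xb: "x tb = ?z" and z: "snd ?z = 0"
    using cand by (cases F; simp add: candidate_def)+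
  obtain a0 where a0: "a0 < tb" "\<And>t. t \<in> {a0..<tb} \<Longrightarrow> ?\<rho> * snd (lam t) > 0"
    using candidate_branch[OF cand] by blast
  \<comment> \<open>The time \<open>tb\<close> is left out: the second adjoint component is zero
    there, which at the lower face selects the other branch.\<close>
  have x_int: "((\<lambda>s. f (x s)) has_integral (x tb - x t)) {t..tb}" if "t \<in> {a0..tb}" for t
  proof (rule has_integral_spike_finite[OF _ _ candidateD(1)[OF cand]])
    fix s assume "s \<in> {t..tb} - {tb}"
    then have "0 \<le> ?\<rho> \<longleftrightarrow> 0 \<le> snd (lam s)"
      using a0(2)[of s] that by (auto simp: zero_less_mult_iff)
    from branch_dist_cong[OF this]
    show "f (x s) = dyn g i (x s) (dist_real g S x lam s)"
      unfolding f_def dist_real_eq_branch_dist by (rule arg_cong[OF fun_cong])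
  qed (use that in auto)
  have contx: "continuous_on {a0..tb} x"
    using a0(1) x_int by (intro continuous_on_if_has_integral) auto
  have fst_int: "((\<lambda>s. snd (x s)) has_integral (fst (x tb) - fst (x t))) {t..tb}" if "t \<in> {a0..tb}" for t
    using has_integral_linear[OF x_int[OF that] bounded_linear_fst] by (simp add: o_def f_def dyn_def)
  have snd_int: "((\<lambda>s. snd (f (x s))) has_integral (snd (x tb) - snd (x t))) {t..tb}" if "t \<in> {a0..tb}" for t
    using has_integral_linear[OF x_int[OF that] bounded_linear_snd] by (simp add: o_def)
  have lip: "norm (f y - f y') \<le> ?L * norm (y - y')" for y y'
    unfolding f_def by (rule dyn_branch_Lipschitz[OF gen])
  have E: "?E = ?\<rho> * snd (f ?z)"
    by (simp add: end_acceleration_def f_def)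
  show thesis
  proof (cases "?E = 0")
    case True
    have "?\<rho> \<noteq> 0" by (cases F) auto
    then have fz: "f ?z = 0"
      using True z by (simp add: E prod_eq_iff) (simp add: f_def dyn_def)
    define a where "a = max a0 (tb - 1 / (2 * ?L))"
    have L: "1 \<le> ?L"
      by (rule field_bound_ge_1[OF gen])
    then have a: "a < tb" "a0 \<le> a" "?L * (tb - a) \<le> 1 / 2"
      using a0 by (auto simp: a_def max_def field_simps)
    \<comment> \<open>Uniqueness at an equilibrium: the largest distance to \<open>?z\<close> on
      this short interval is at most half of itself, hence zero.\<close>
    obtain s where s: "s \<in> {a..tb}" "\<And>t. t \<in> {a..tb} \<Longrightarrow> norm (?z - x t) \<le> norm (?z - x s)"
    proof -
      have "continuous_on {a..tb} (\<lambda>t. norm (?z - x t))"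
        using a by (intro continuous_intros continuous_on_subset[OF contx]) auto
      then show thesis
        using continuous_attains_sup[of "{a..tb}" "\<lambda>t. norm (?z - x t)"] a that by auto
    qed
    have "norm (x tb - x s) \<le> ?L * norm (?z - x s) * measure lborel {s..tb}"
    proof (rule has_integral_bound_real[OF _ _ x_int])
      show "norm (f (x t)) \<le> ?L * norm (?z - x s)" if "t \<in> {s..tb} - {}" for t
      proof -
        have "norm (f (x t)) \<le> ?L * norm (?z - x t)"
          using lip[of "x t" ?z] fz by (simp add: norm_minus_commute)
        also have "\<dots> \<le> ?L * norm (?z - x s)"
          using that s L by (intro mult_left_mono s(2)) auto
        finally show ?thesis .
      qed
    qed (use s a L in auto)
    also have "\<dots> = ?L * (tb - s) * norm (?z - x s)"
      using s by simp
    also have "\<dots> \<le> ?L * (tb - a) * norm (?z - x s)"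
      using s L by (intro mult_right_mono mult_left_mono) auto
    also have "\<dots> \<le> 1 / 2 * norm (?z - x s)"
      using a by (intro mult_right_mono) auto
    finally have "norm (?z - x s) \<le> 0"
      by (simp add: xb)
    then have "x t = ?z" if "t \<in> {a..tb}" for t
      using s(2)[OF that] by simp
    then show thesis
      using that[of a] a True by simp
  next
    case False
    \<comment> \<open>This orientation makes the end acceleration equal to
      \<open>- \<bar>?E\<bar>\<close>, covering both faces and both signs of \<open>?E\<close> in
      one argument.\<close>
    define \<sigma> where "\<sigma> = - sgn ?E * ?\<rho>"
    have \<sigma>E: "\<sigma> * snd (f ?z) = - \<bar>?E\<bar>"
      by (simp add: \<sigma>_def E abs_sgn mult_ac)
    have "((\<lambda>t. snd (f (x t))) \<longlongrightarrow> snd (f (x tb))) (at_left tb)"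
    proof -
      have "continuous_on UNIV f"
        unfolding f_def dyn_def using gen
        by (auto intro!: continuous_intros simp: generator_def)
      then have "isCont f (x tb)"
        using continuous_on_eq_continuous_at open_UNIV by blast
      from tendsto_snd[OF isCont_tendsto_compose[OF this candidate_tendsto(1)[OF cand]]] show ?thesis .
    qed
    then have "((\<lambda>t. \<sigma> * snd (f (x t))) \<longlongrightarrow> - \<bar>?E\<bar>) (at_left tb)"
      using tendsto_mult_left[of _ _ _ \<sigma>] \<sigma>E xb by fastforce
    then have "\<forall>\<^sub>F t in at_left tb. \<sigma> * snd (f (x t)) < - (\<bar>?E\<bar> / 2)"
      using False by (intro order_tendstoD) auto
    moreover have "\<forall>\<^sub>F t in at_left tb. a0 \<le> t"
      using a0(1) unfolding eventually_at_left_field by (intro exI[of _ a0]) simp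
    ultimately have ev: "\<forall>\<^sub>F t in at_left tb. \<sigma> * snd (f (x t)) < - (\<bar>?E\<bar> / 2) \<and> a0 \<le> t"
      by (rule eventually_conj)
    have "\<sigma> * snd (f (x tb)) < - (\<bar>?E\<bar> / 2) \<and> a0 \<le> tb"
      using False a0(1) by (simp add: xb \<sigma>E)
    with ev obtain a where
      a: "a < tb" "\<And>t. t \<in> {a..tb} \<Longrightarrow> \<sigma> * snd (f (x t)) < - (\<bar>?E\<bar> / 2) \<and> a0 \<le> t"
      by (rule eventually_at_left_Icc) blast
    have \<omega>: "\<bar>?E\<bar> / 2 * (tb - t) \<le> \<sigma> * snd (x t)" if t: "t \<in> {a..tb}" for t
    proof -
      have "\<sigma> * snd (x tb) + \<bar>?E\<bar> / 2 * (tb - t) \<le> \<sigma> * snd (x t)"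
      proof (rule integral_lower_bound[where f = "\<lambda>s. \<sigma> * snd (f (x s))"])
        show "((\<lambda>s. \<sigma> * snd (f (x s))) has_integral \<sigma> * snd (x tb) - \<sigma> * snd (x t)) {t..tb}"
          using has_integral_mult_right[OF snd_int[of t], of \<sigma>] a(2)[OF t] t by (simp add: right_diff_distrib)
        show "\<sigma> * snd (f (x s)) \<le> - (\<bar>?E\<bar> / 2)" if "s \<in> {t..tb}" for s
          using a(2)[of s] t that by auto
      qed (use t in auto)
      then show ?thesis by (simp add: xb z)
    qed
    have pos: "\<sigma> * (fst ?z - fst (x t)) > 0" if t: "t \<in> {a..<tb}" for t
    proof -
      \<comment> \<open>Integrating a second time: the oriented velocity is at least
        \<open>2 * c * (tb - s)\<close>, with antiderivative \<open>h\<close>, so the displacement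
        is at least quadratic in the remaining time.\<close>
      define c where "c = \<bar>?E\<bar> / 4"
      define h where "h s = - c * (tb - s)\<^sup>2" for s
      have "(h has_real_derivative 2 * c * (tb - s)) (at s within {t..tb})" for s
        unfolding h_def by (auto intro!: derivative_eq_intros simp: algebra_simps)
      then have lower: "((\<lambda>s. 2 * c * (tb - s)) has_integral h tb - h t) {t..tb}"
        using t by (intro fundamental_theorem_of_calculus[where f = h])
          (auto simp: has_real_derivative_iff_has_vector_derivative)
      have upper: "((\<lambda>s. \<sigma> * snd (x s)) has_integral \<sigma> * (fst (x tb) - fst (x t))) {t..tb}"
        using a(2)[of t] t by (intro has_integral_mult_right fst_int) simp
      have "h tb - h t \<le> \<sigma> * (fst (x tb) - fst (x t))"
      proof (rule has_integral_le[OF lower upper])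
        show "2 * c * (tb - s) \<le> \<sigma> * snd (x s)" if "s \<in> {t..tb}" for s
          using \<omega>[of s] t that by (simp add: c_def)
      qed
      moreover have "0 < h tb - h t"
        using False t by (simp add: h_def c_def)
      ultimately show ?thesis
        by (simp add: xb)
    qed
    show thesis
    proof (rule that[OF a(1)])
      fix t assume "t \<in> {a..<tb}"
      from pos[OF this] have "0 < sgn ?E * (?\<rho> * (fst (x t) - fst ?z))"
        by (simp add: \<sigma>_def algebra_simps)
      moreover have "sgn w = sgn ?E" if "0 < sgn ?E * w" for w
        using that False by (simp add: sgn_if split: if_splits)
      ultimately show "sgn (?\<rho> * (fst (x t) - fst ?z)) = sgn ?E"
        by blast
    qed
  qed
qed

text \<open>The sign of the acceleration decides about the constraint that is active at the end
  point. The opposite constraint is strict near \<open>tb\<close> by continuity, because the two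
  bounds are a positive distance apart.\<close>

lemma candidate_partly_in_G_minus_iff:
  assumes gen: "generator g i" and cand: "candidate g i S F tb x lam"
  shows "partly_in_G_minus g i tb x \<longleftrightarrow> end_acceleration g i S F < 0"
proof -
  let ?\<rho> = "fst (constraint_gradient F)" and ?z = "fst (tangency_point g i F)"
  let ?E = "end_acceleration g i S F"
  have lohi: "ang_lo g i < ang_hi g i"
    using gen by (simp add: generator_def)
  obtain a where a: "a < tb" "\<And>t. t \<in> {a..<tb} \<Longrightarrow> sgn (?\<rho> * (fst (x t) - ?z)) = sgn ?E"
    by (rule candidate_near_end[OF gen cand]) blast
  have inside: "?\<rho> * (fst y - ?z) < 0" if "y \<in> G_minus g i" for y
    using that by (cases F) (auto simp: G_minus_def)
  show ?thesis
  proof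
    assume "partly_in_G_minus g i tb x"
    then obtain t0 where t0: "t0 < tb" "\<And>t. t \<in> {t0<..<tb} \<Longrightarrow> x t \<in> G_minus g i"
      by (auto simp: partly_in_G_minus_def)
    define t where "t = (max a t0 + tb) / 2"
    have "t \<in> {t0<..<tb}" "t \<in> {a..<tb}"
      using a(1) t0(1) by (auto simp: t_def max_def field_simps)
    with inside[OF t0(2)] a(2) have "sgn ?E = - 1"
      by (metis sgn_neg)
    then show "?E < 0"
      by (simp add: sgn_if split: if_splits)
  next
    assume "?E < 0"
    have lim: "((\<lambda>t. fst (x t)) \<longlongrightarrow> ?z) (at_left tb)"
      using tendsto_fst[OF candidate_tendsto(1)[OF cand]] cand by (simp add: candidate_def)
    have near: "\<forall>\<^sub>F t in at_left tb. \<bar>fst (x t) - ?z\<bar> < ang_hi g i - ang_lo g i"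
      using tendstoD[OF lim, of "ang_hi g i - ang_lo g i"] lohi by (simp add: dist_norm)
    then obtain c where c: "c < tb" "\<And>t. c < t \<Longrightarrow> t < tb \<Longrightarrow> \<bar>fst (x t) - ?z\<bar> < ang_hi g i - ang_lo g i"
      by (auto simp: eventually_at_left_field)
    have "x t \<in> G_minus g i" if "t \<in> {max a c<..<tb}" for t
    proof -
      have "sgn (?\<rho> * (fst (x t) - ?z)) = - 1"
        using a(2)[of t] that \<open>?E < 0\<close> by simp
      then have "sgn (?\<rho> * (fst (x t) - ?z)) < 0"
        by simp
      then have "?\<rho> * (fst (x t) - ?z) < 0"
        by (simp only: sgn_less)
      then show ?thesis
        using c(2)[of t] that by (cases F) (auto simp: G_minus_def)
    qed
    then show "partly_in_G_minus g i tb x"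
      unfolding partly_in_G_minus_def using a(1) c(1) by (intro exI[of _ "max a c"]) auto
  qed
qed

section \<open>From the sign of the end acceleration to the inequalities\<close>

lemma end_acceleration_eq:
  assumes "candidate g i S F tb x lam"
  shows "end_acceleration g i S F = fst (constraint_gradient F) *
    (torque g i - (\<Sum>j\<in>nbrs g i. coupling g i j *
      sin (fst (tangency_point g i F) - end_dist g S x lam tb j))) / mass g i"
  unfolding end_acceleration_def candidate_end_dist[OF assms]
  by (cases F) (simp_all add: dyn_def)

text \<open>The end acceleration is the same for all candidates of the given face and set. So the
  inequality for any one of them decides whether some candidate enters
  \<open>G_minus\<close>.\<close>

lemma candidate_characterisation:
  assumes gen: "generator g i" and cand: "candidate g i S F tb x lam"
  shows "(\<exists>tb x lam. candidate g i S F tb x lam \<and> partly_in_G_minus g i tb x) \<longleftrightarrow>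
    fst (constraint_gradient F) *
    ((\<Sum>j\<in>nbrs g i. coupling g i j * sin (fst (tangency_point g i F) - end_dist g S x lam tb j))
      - torque g i) > 0"
proof -
  have "mass g i > 0"
    using gen by (simp add: generator_def)
  then have "end_acceleration g i S F < 0 \<longleftrightarrow> fst (constraint_gradient F) *
    ((\<Sum>j\<in>nbrs g i. coupling g i j * sin (fst (tangency_point g i F) - end_dist g S x lam tb j))
      - torque g i) > 0"
    unfolding end_acceleration_eq[OF cand] by (cases F) (auto simp: divide_less_0_iff)
  then show ?thesis
    using cand candidate_partly_in_G_minus_iff[OF gen, of S F] by blast
qed

text \<open>The existence claims keep the equivalences from holding vacuously. The gradient entries
  1 and -1 produce the opposite directions of the two inequalities.\<close>

theorem proposition1:
  fixes g :: "'n grid" and i :: 'n and S :: safe_set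
  assumes "generator g i"
  shows
    "((\<exists>tb x lam. candidate g i S Upper tb x lam) \<and>
      (\<forall>tb x lam. candidate g i S Upper tb x lam \<longrightarrow>
         ((\<exists>tb' x' lam'. candidate g i S Upper tb' x' lam' \<and> partly_in_G_minus g i tb' x')
          \<longleftrightarrow> (\<Sum>j\<in>nbrs g i. coupling g i j * sin (ang_hi g i - end_dist g S x lam tb j))
                 - torque g i > 0))) \<and>
     ((\<exists>tb x lam. candidate g i S Lower tb x lam) \<and>
      (\<forall>tb x lam. candidate g i S Lower tb x lam \<longrightarrow>
         ((\<exists>tb' x' lam'. candidate g i S Lower tb' x' lam' \<and> partly_in_G_minus g i tb' x')
          \<longleftrightarrow> (\<Sum>j\<in>nbrs g i. coupling g i j * sin (ang_lo g i - end_dist g S x lam tb j))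
                 - torque g i < 0)))"
  using candidate_exists[OF assms, of S] candidate_characterisation[OF assms, of S Upper]
    candidate_characterisation[OF assms, of S Lower]
  by simp

end
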